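(* Let $u(\mathbf x,y,t)$ be governed by a linear PDE $$\frac{\partial u}{\partial t}=\sum_{|\mathbf k|=0}^{\infty}\mathfrak L_{\mathbf k}\,\partial_{\mathbf x}^{\mathbf k}u,\qquad \mathbf x\in\mathbb X,$$ of the class described in the context, satisfying the spectral assumption (Assumption S) of the context. Define the macroscale field $U:\mathbb X\times\mathbb R\to\mathbb R^m$ by $U(\mathbf x,t):=\langle Z^{\mathbf 0}(y),u(\mathbf x,y,t)\rangle$. Then, in the regime of slowly varying solutions, $U$ satisfies the PDE $$\frac{\partial U}{\partial t}=\sum_{|\mathbf n|=0}^{N}A_{\mathbf n}\,\partial_{\mathbf x}^{\mathbf n}U,\qquad \mathbf x\in\mathbb X,$$ in terms of the $m\times m$ matrices $A_{\mathbf n}$ constructed in the context, to a closure error quantified by the remainder $\rho$ below, and upon neglecting transients decaying exponentially quickly in time. Precisely: for every $\mathbf X\in\mathbb X$ there is a rate $\gamma$ with $\alpha<\gamma<\beta$ such that, as $t\to\infty$, $$\left.\frac{\partial U}{\partial t}\right|_{\mathbf x=\mathbf X}=\sum_{|\mathbf n|=0}^{N}A_{\mathbf n}\left.\partial_{\mathbf x}^{\mathbf n}U\right|_{\mathbf x=\mathbf X}+\rho+O(e^{-\gamma t}),$$ where $$\rho=\langle Z^{\mathbf 0},\tilde{\mathcal V}\tilde r_c\rangle_{\boldsymbol\xi=\mathbf 0}+\langle Z^{\mathbf 0},\tilde{\mathcal W}\mathcal B\,e^{\mathcal Bt}\star\tilde r_s\rangle_{\boldsymbol\xi=\mathbf 0}+\langle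 Z^{\mathbf 0},\tilde{\mathcal W}\tilde r_s\rangle_{\boldsymbol\xi=\mathbf 0}-\sum_{|\mathbf n|=0}^{N}A_{\mathbf n}\langle Z^{\mathbf 0},\partial_{\boldsymbol\xi}^{\mathbf n}\tilde{\mathcal W}\,e^{\mathcal Bt}\star\tilde r_s\rangle_{\boldsymbol\xi=\mathbf 0},$$ and the stated macroscale PDE is this identity with $\rho$ and the $O(e^{-\gamma t})$ transients neglected.
   Context: Multi-indices: $\mathbb N_0=\{0,1,2,\ldots\}$; for $\mathbf k\in\mathbb N_0^M$, $|\mathbf k|=k_1+\cdots+k_M$, $\mathbf k!=k_1!\cdots k_M!$, $\mathbf x^{\mathbf k}=x_1^{k_1}\cdots x_M^{k_M}$, $\partial_{\mathbf x}^{\mathbf k}=\partial^{|\mathbf k|}/\partial x_1^{k_1}\cdots\partial x_M^{k_M}$, binomial coefficients of multi-indices are products of componentwise binomials, $\mathbf k\le\mathbf n$ is meant componentwise, and $\boldsymbol\ell<\mathbf n$ means $\boldsymbol\ell\le\mathbf n$ and $\boldsymbol\ell\ne\mathbf n$. $\sum_{|\mathbf k|=a}^{b}$ is a sum over all multi-indices with $a\le|\mathbf k|\le b$. Setting: $\mathbb X\subset\mathbb R^M$ is an open domain (macroscale), $\mathbb Y$ is the cross-sectional (microscale) domain, and $\mathbb U$ is a (finite or infinite dimensional) Hilbert space of field values with real inner product $\langle\cdot,\cdot\rangle$; $u:\mathbb X\times\mathbb Y\times\mathbb R\to\mathbb U$, where the dependence on the cross-section variable $y\in\mathbb Y$ is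 regarded as part of the structure of $\mathbb U$, i.e. for fixed $(\mathbf x,t)$ the field over the cross-section is an element of $\mathbb U$. The operators $\mathfrak L_{\mathbf k}$ are linear operators on $\mathbb U$, independent of $t$ and $\mathbf x$ (they act only in the cross-section), and only finitely many are non-zero. Fix a truncation order $N$; $u$ has $2N$ continuous derivatives in $\mathbf x$, $u\in C^{2N}(\mathbb X\times\mathbb Y\times\mathbb R,\mathbb U)$. Assumption S. (1) $\mathbb U$ is the direct sum of two closed $\mathfrak L_{\mathbf 0}$-invariant subspaces $\mathbb E_c^0,\mathbb E_s^0$, and the corresponding restrictions of $\mathfrak L_{\mathbf 0}$ generate strongly continuous semigroups. (2) $\mathfrak L_{\mathbf 0}$ has a discrete spectrum of eigenvalues $\lambda_1,\lambda_2,\ldots$ (repeated according to multiplicity) with corresponding linearly independent (generalised) eigenvectors $v_1^{\mathbf 0},v_2^{\mathbf 0},\ldots$ that are complete, $\mathbb U=\operatorname{span}\{v_1^{\mathbf 0},v_2^{\mathbf 0},\ldots\}$. (3) The first $m$ eigenvalues satisfy $|\operatorname{Re}\lambda_j|\le\alpha$, and $\mathbb E_c^0=\operatorname{span}\{v_1^{\mathbf 0},\ldots,v_m^{\mathbf 0}\}$ (centre subspace). (4) All other eigenvalues satisfy $\operatorname{Re}\lambda_j\le-\beta<-N\alpha$ for $j=m+1,m+2,\ldots$, and $\mathbb E_s^0=\operatorname{span}\{v_{m+1}^{\mathbf 0},v_{m+2}^{\mathbf 0},\ldots\}$ (stable subspace). Basic eigen-data: $V^{\mathbf 0}=[v_1^{\mathbf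 0}\ \cdots\ v_m^{\mathbf 0}]\in\mathbb U^{1\times m}$; $A_{\mathbf 0}\in\mathbb R^{m\times m}$ is defined by $\mathfrak L_{\mathbf 0}V^{\mathbf 0}=V^{\mathbf 0}A_{\mathbf 0}$; $Z^{\mathbf 0}\in\mathbb U^{1\times m}$ has $m$ linearly independent columns spanning the corresponding centre subspace of the adjoint $\mathfrak L_{\mathbf 0}^\dagger$, normalised so that $\langle Z^{\mathbf 0},V^{\mathbf 0}\rangle=I_m$. Inner products of rows of elements of $\mathbb U$ are taken elementwise and give matrices. Recursion: for $0<|\mathbf n|\le N$ define $A_{\mathbf n}\in\mathbb R^{m\times m}$ and $V^{\mathbf n}\in\mathbb U^{1\times m}$ recursively by $A_{\mathbf n}:=\sum_{0<|\mathbf k|,\,\mathbf k\le\mathbf n}\langle Z^{\mathbf 0},\mathfrak L_{\mathbf k}V^{\mathbf n-\mathbf k}\rangle$, $\mathfrak L_{\mathbf 0}V^{\mathbf n}-V^{\mathbf n}A_{\mathbf 0}=-\sum_{0<|\mathbf k|,\,\mathbf k\le\mathbf n}\mathfrak L_{\mathbf k}V^{\mathbf n-\mathbf k}+\sum_{0<|\mathbf k|,\,\mathbf k\le\mathbf n}V^{\mathbf n-\mathbf k}A_{\mathbf k}$, $\langle Z^{\mathbf 0},V^{\mathbf n}\rangle=0_m$. Generating multinomials: $\boldsymbol\xi\in\mathbb R^M$ is an indeterminate, $\mathbb G_N$ is the space of multinomials in $\boldsymbol\xi$ of degree $\le N$, $\mathbb U_N=\mathbb U\otimes\mathbb G_N$,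 and $\tilde{\mathcal L}=\sum_{|\mathbf k|=0}^N\mathfrak L_{\mathbf k}\partial_{\boldsymbol\xi}^{\mathbf k}:\mathbb U_N\to\mathbb U_N$. A subscript $\boldsymbol\xi=\mathbf 0$ denotes evaluation there. $\tilde{\mathcal V}$ is the collection of the columns of $\tilde{\mathcal V}^{\mathbf n}:=\sum_{\mathbf 0\le\mathbf k\le\mathbf n}V^{\mathbf n-\mathbf k}\,\boldsymbol\xi^{\mathbf k}/\mathbf k!$ over all $0\le|\mathbf n|\le N$; these form a basis of the centre subspace $\mathbb E_c^N$ of $\tilde{\mathcal L}$. $\tilde{\mathcal W}$ is a basis of the stable subspace $\mathbb E_s^N$ of $\tilde{\mathcal L}$, and $\mathcal B$ is the operator with $\tilde{\mathcal L}\tilde{\mathcal W}=\tilde{\mathcal W}\mathcal B$ (the restriction of $\tilde{\mathcal L}$ to $\mathbb E_s^N$), all of whose eigenvalues have real part $\le-\beta$. Convolution: $f(t)\star g(t)=\int_0^tf(t-\tau)g(\tau)\,d\tau$. Coupling term at a station $\mathbf X\in\mathbb X$: for $|\boldsymbol\ell|=N$, $u^{(\boldsymbol\ell)}(\mathbf X,\mathbf x,y,t):=N\int_0^1(1-s)^{N-1}\,\partial_{\mathbf x}^{\boldsymbol\ell}u\big|_{\mathbf X+s(\mathbf x-\mathbf X)}\,ds$ for $\mathbf x$ near $\mathbf X$, and $$\tilde r=\sum_{|\mathbf n|=0}^N\frac{\boldsymbol\xi^{\mathbf n}}{\mathbf n!}r_{\mathbf n},\qquad r_{\mathbf n}=\sum_{|\mathbf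 k|\ge1}\ \sum_{|\boldsymbol\ell|=N,\ \boldsymbol\ell<\mathbf n+\mathbf k}\mathfrak L_{\mathbf k}\binom{\mathbf k+\mathbf n}{\boldsymbol\ell}\left[\partial_{\mathbf x}^{\mathbf k+\mathbf n-\boldsymbol\ell}u^{(\boldsymbol\ell)}(\mathbf X,\mathbf x,y,t)\right]_{\mathbf x=\mathbf X}.$$ The components $\tilde r_c(t),\tilde r_s(t)$ are the coordinates of $\tilde r$ in the complete basis $\{\tilde{\mathcal V},\tilde{\mathcal W}\}$: $\tilde r=\tilde{\mathcal V}\tilde r_c+\tilde{\mathcal W}\tilde r_s$. "Regime of slowly varying solutions" means the regime in which the remainder $\rho$, which is of the order of the $(N+1)$th spatial derivatives of $u$, is negligible.
   Formalization: Added: the growth of e^{Bt} is determined by the eigenvalues of B (automatic in finite dimensions; the claim can fail otherwise); the L_k are closed; each L_k ∂_x^k u is defined and C^N in x; u has at least N+|k| continuous derivatives for every nonzero L_k. *)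

theory Defs
  imports "HOL-Analysis.Analysis" "HOL-Library.Function_Algebras" "HOL-Library.Landau_Symbols"
begin

text \<open>Multi-indices are elements of \<open>nat ^ 'M\<close>; the library order on vectors is the
  componentwise one, with \<open>l < n\<close> meaning \<open>l \<le> n \<and> l \<noteq> n\<close>.\<close>

definition mabs :: "nat ^ 'M::finite \<Rightarrow> nat"
  where "mabs k = (\<Sum>i\<in>UNIV. k $ i)"

definition mfact :: "nat ^ 'M::finite \<Rightarrow> real"
  where "mfact k = (\<Prod>i\<in>UNIV. fact (k $ i))"

definition mbinom :: "nat ^ 'M::finite \<Rightarrow> nat ^ 'M \<Rightarrow> real"
  where "mbinom n k = (\<Prod>i\<in>UNIV. real ((n $ i) choose (k $ i)))"

primrec Ck_on :: "nat \<Rightarrow> 'a::euclidean_space set \<Rightarrow> ('a \<Rightarrow> 'b::real_normed_vector) \<Rightarrow> bool" where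
  "Ck_on 0 S f \<longleftrightarrow> continuous_on S f"
| "Ck_on (Suc r) S f \<longleftrightarrow> (\<forall>x\<in>S. f differentiable (at x)) \<and>
     (\<forall>b\<in>Basis. Ck_on r S (\<lambda>x. frechet_derivative f (at x) b))"

definition partial :: "'M::finite \<Rightarrow> (real ^ 'M \<Rightarrow> 'b::real_normed_vector) \<Rightarrow> real ^ 'M \<Rightarrow> 'b"
  where "partial i f = (\<lambda>x. frechet_derivative f (at x) (axis i 1))"

text \<open>The order in which the partial derivatives are taken is left to the choice operator; it is
  irrelevant for functions whose derivatives up to order \<open>mabs k\<close> are continuous.\<close>

definition mderiv ::
    "nat ^ 'M::finite \<Rightarrow> (real ^ 'M \<Rightarrow> 'b::real_normed_vector) \<Rightarrow> real ^ 'M \<Rightarrow> 'b"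
  where "mderiv k f = foldr partial (SOME is. \<forall>i. count_list is i = k $ i) f"

text \<open>A linear operator, possibly unbounded, is given by its domain \<open>D\<close> and a function \<open>L\<close> whose
  values off \<open>D\<close> are irrelevant; everywhere defined operators are the case \<open>D = UNIV\<close>.\<close>

definition linear_op :: "'a::real_vector set \<Rightarrow> ('a \<Rightarrow> 'a) \<Rightarrow> bool"
  where "linear_op D L \<longleftrightarrow> subspace D \<and> (\<forall>x\<in>D. \<forall>y\<in>D. L (x + y) = L x + L y) \<and>
    (\<forall>c. \<forall>x\<in>D. L (c *\<^sub>R x) = c *\<^sub>R L x)"

definition closed_op :: "'a::real_normed_vector set \<Rightarrow> ('a \<Rightarrow> 'a) \<Rightarrow> bool"
  where "closed_op D L \<longleftrightarrow> linear_op D L \<and> closed {(v, L v) | v. v \<in> D}"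

text \<open>Spectral notions refer to the complexification: the pair \<open>(p, q)\<close> stands for \<open>p + \<i> q\<close>, and
  \<open>cshift L \<mu>\<close> is the operator \<open>L - \<mu>\<close> acting on such pairs.\<close>

definition cshift :: "('a::real_vector \<Rightarrow> 'a) \<Rightarrow> complex \<Rightarrow> 'a \<times> 'a \<Rightarrow> 'a \<times> 'a"
  where "cshift L \<mu> = (\<lambda>(p, q).
    (L p - (Re \<mu> *\<^sub>R p - Im \<mu> *\<^sub>R q), L q - (Re \<mu> *\<^sub>R q + Im \<mu> *\<^sub>R p)))"

definition is_eigenvalue :: "'a::real_vector set \<Rightarrow> ('a \<Rightarrow> 'a) \<Rightarrow> complex \<Rightarrow> bool"
  where "is_eigenvalue D L \<mu> \<longleftrightarrow> (\<exists>w\<in>D \<times> D. w \<noteq> 0 \<and> cshift L \<mu> w = 0)"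

definition op_spectrum :: "'a::real_normed_vector set \<Rightarrow> ('a \<Rightarrow> 'a) \<Rightarrow> complex set"
  where "op_spectrum D L = - {\<mu>. bij_betw (cshift L \<mu>) (D \<times> D) UNIV \<and>
    (\<exists>C. \<forall>w\<in>D \<times> D. norm w \<le> C * norm (cshift L \<mu> w))}"

text \<open>The real vectors spanned by the real and imaginary parts of the generalised eigenvectors for
  \<open>\<mu>\<close>; the spaces for \<open>\<mu>\<close> and for its complex conjugate coincide.\<close>

definition gen_eigenspace :: "'a::real_vector set \<Rightarrow> ('a \<Rightarrow> 'a) \<Rightarrow> complex \<Rightarrow> 'a set"
  where "gen_eigenspace D L \<mu> = {p. \<exists>q r. (\<forall>i<r. (cshift L \<mu> ^^ i) (p, q) \<in> D \<times> D) \<and>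
    (cshift L \<mu> ^^ r) (p, q) = 0}"

definition spectral_subspace ::
    "'a::{real_vector, topological_space} set \<Rightarrow> ('a \<Rightarrow> 'a) \<Rightarrow> (complex \<Rightarrow> bool) \<Rightarrow> 'a set"
  where "spectral_subspace D L P = closure (span (\<Union>\<mu>\<in>{\<mu>. P \<mu>}. gen_eigenspace D L \<mu>))"

definition adj_dom :: "'a::real_inner set \<Rightarrow> ('a \<Rightarrow> 'a) \<Rightarrow> 'a set"
  where "adj_dom D L = {z. \<exists>w. \<forall>v\<in>D. z \<bullet> L v = w \<bullet> v}"

definition adj_op :: "'a::real_inner set \<Rightarrow> ('a \<Rightarrow> 'a) \<Rightarrow> 'a \<Rightarrow> 'a"
  where "adj_op D L z = (THE w. \<forall>v\<in>D. z \<bullet> L v = w \<bullet> v)"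

definition c0_semigroup_on ::
    "'a::real_normed_vector set \<Rightarrow> (real \<Rightarrow> 'a \<Rightarrow> 'a) \<Rightarrow> bool"
  where "c0_semigroup_on E T \<longleftrightarrow>
    (\<forall>t\<ge>0. T t ` E \<subseteq> E \<and> linear_op E (T t) \<and> (\<exists>C. \<forall>x\<in>E. norm (T t x) \<le> C * norm x)) \<and>
    (\<forall>x\<in>E. T 0 x = x) \<and>
    (\<forall>s\<ge>0. \<forall>t\<ge>0. \<forall>x\<in>E. T (s + t) x = T s (T t x)) \<and>
    (\<forall>x\<in>E. ((\<lambda>t. T t x) \<longlongrightarrow> x) (at_right 0))"

text \<open>The restriction of \<open>L\<close>, with domain \<open>D\<close>, is the generator of the semigroup \<open>T\<close> on \<open>E\<close>.\<close>

definition generates_on ::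
    "'a::real_normed_vector set \<Rightarrow> 'a set \<Rightarrow> ('a \<Rightarrow> 'a) \<Rightarrow> (real \<Rightarrow> 'a \<Rightarrow> 'a) \<Rightarrow> bool"
  where "generates_on E D L T \<longleftrightarrow> c0_semigroup_on E T \<and> D \<subseteq> E \<and>
    (\<forall>x\<in>E. \<forall>y. ((\<lambda>h. (T h x - x) /\<^sub>R h) \<longlongrightarrow> y) (at_right 0) \<longleftrightarrow> x \<in> D \<and> y = L x)"

text \<open>Spectrum-determined growth: the growth rate of the semigroup \<open>T\<close> is controlled by the real
  parts of the eigenvalues of its generator. This is automatic in finite dimensions, but not for
  every strongly continuous semigroup whose generator has discrete spectrum.\<close>

definition spectrum_determined_growth ::
    "'a::real_normed_vector set \<Rightarrow> ('a \<Rightarrow> 'a) \<Rightarrow> (real \<Rightarrow> 'a \<Rightarrow> 'a) \<Rightarrow> bool"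
  where "spectrum_determined_growth D L T \<longleftrightarrow>
    (\<forall>b. (\<forall>\<mu>. is_eigenvalue D L \<mu> \<longrightarrow> Re \<mu> \<le> b) \<longrightarrow>
      (\<forall>b'>b. \<exists>C. \<forall>t\<ge>0. \<forall>x. norm (T t x) \<le> C * exp (b' * t) * norm x))"

text \<open>The type \<open>'u ^ 'm\<close> is the space of rows of \<open>m\<close> elements of the field space.\<close>

definition row_mat :: "'u::real_vector ^ 'm::finite \<Rightarrow> real ^ 'm ^ 'm \<Rightarrow> 'u ^ 'm"
  where "row_mat V A = (\<chi> j. \<Sum>i\<in>UNIV. (A $ i $ j) *\<^sub>R (V $ i))"

definition row_apply :: "('u \<Rightarrow> 'u) \<Rightarrow> 'u ^ 'm::finite \<Rightarrow> 'u ^ 'm"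
  where "row_apply L V = (\<chi> j. L (V $ j))"

definition gram :: "'u::real_inner ^ 'm::finite \<Rightarrow> 'u ^ 'm \<Rightarrow> real ^ 'm ^ 'm"
  where "gram Z V = (\<chi> i j. (Z $ i) \<bullet> (V $ j))"

definition pair :: "'u::real_inner ^ 'm::finite \<Rightarrow> 'u \<Rightarrow> real ^ 'm"
  where "pair Z v = (\<chi> i. (Z $ i) \<bullet> v)"

definition op_support :: "('k \<Rightarrow> 'u::real_vector set) \<Rightarrow> ('k \<Rightarrow> 'u \<Rightarrow> 'u) \<Rightarrow> 'k set"
  where "op_support D L = {k. \<not> (D k = UNIV \<and> (\<forall>v. L k v = 0))}"

text \<open>Classical solutions. For operators that are not everywhere defined, smoothness of \<open>u\<close> also in
  the cross-section means that the terms of the equation take their arguments in the domains and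
  are themselves smooth in \<open>x\<close>; this is automatic for bounded operators. The smoothness order \<open>r\<close>
  is twice \<open>N\<close>, or larger if needed for the coupling term to be defined when the equation contains
  derivatives of order above \<open>N\<close>.\<close>

definition pde_solution ::
    "(nat ^ 'M::finite \<Rightarrow> 'u::real_normed_vector set) \<Rightarrow> (nat ^ 'M \<Rightarrow> 'u \<Rightarrow> 'u) \<Rightarrow> nat \<Rightarrow>
     (real ^ 'M) set \<Rightarrow> (real ^ 'M \<Rightarrow> real \<Rightarrow> 'u) \<Rightarrow> bool"
  where "pde_solution D L N S u \<longleftrightarrow>
    (\<exists>r\<ge>2 * N. (\<forall>k\<in>op_support D L. N + mabs k \<le> r) \<and>
       Ck_on r (S \<times> UNIV) (\<lambda>(x, t). u x t)) \<and>
    (\<forall>k\<in>op_support D L. \<forall>t. (\<forall>x\<in>S. mderiv k (\<lambda>x. u x t) x \<in> D k) \<and>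
       Ck_on N S (\<lambda>x. L k (mderiv k (\<lambda>x. u x t) x))) \<and>
    (\<forall>x\<in>S. \<forall>t. ((\<lambda>t. u x t) has_vector_derivative
       (\<Sum>k\<in>op_support D L. L k (mderiv k (\<lambda>x. u x t) x))) (at t))"

text \<open>The eigenvalues and (real) generalised eigenvectors are indexed by \<open>UNIV <+> J\<close>: the \<open>m\<close>
  centre ones by the finite type \<open>'m\<close>, the remaining ones, finitely or infinitely many, by
  \<open>J :: nat set\<close>. A non-real conjugate pair of eigenvalues corresponds to real and imaginary parts
  of generalised eigenvectors.\<close>

definition spectral_assumption ::
    "'u::{real_inner, banach} set \<Rightarrow> ('u \<Rightarrow> 'u) \<Rightarrow> nat \<Rightarrow> real \<Rightarrow> real \<Rightarrow> nat set \<Rightarrow>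
     ('m::finite + nat \<Rightarrow> complex) \<Rightarrow> ('m + nat \<Rightarrow> 'u) \<Rightarrow> 'u set \<Rightarrow> 'u set \<Rightarrow> bool"
  where "spectral_assumption D L N \<alpha> \<beta> J ev v Ec Es \<longleftrightarrow>
    (subspace Ec \<and> closed Ec \<and> subspace Es \<and> closed Es \<and>
     Ec \<inter> Es = {0} \<and> (\<forall>x. \<exists>c\<in>Ec. \<exists>s\<in>Es. x = c + s) \<and>
     L ` (D \<inter> Ec) \<subseteq> Ec \<and> L ` (D \<inter> Es) \<subseteq> Es \<and>
     (\<exists>T. generates_on Ec (D \<inter> Ec) L T) \<and> (\<exists>T. generates_on Es (D \<inter> Es) L T)) \<and>
    (op_spectrum D L = ev ` (UNIV <+> J) \<and>
     (\<forall>\<mu>\<in>op_spectrum D L. \<not> \<mu> islimpt op_spectrum D L) \<and>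
     (\<forall>\<mu>. finite {j \<in> UNIV <+> J. ev j = \<mu>} \<and>
       card {j \<in> UNIV <+> J. ev j = cnj \<mu>} = card {j \<in> UNIV <+> J. ev j = \<mu>} \<and>
       gen_eigenspace D L \<mu> = span (v ` {j \<in> UNIV <+> J. ev j = \<mu> \<or> ev j = cnj \<mu>})) \<and>
     inj_on v (UNIV <+> J) \<and> independent (v ` (UNIV <+> J)) \<and>
     closure (span (v ` (UNIV <+> J))) = UNIV) \<and>
    ((\<forall>i. \<bar>Re (ev (Inl i))\<bar> \<le> \<alpha>) \<and> Ec = span (range (\<lambda>i. v (Inl i)))) \<and>
    ((\<forall>j\<in>J. Re (ev (Inr j)) \<le> - \<beta>) \<and> - \<beta> < - (real N * \<alpha>) \<and>
     Es = closure (span ((\<lambda>j. v (Inr j)) ` J)))"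

text \<open>The membership condition says that the products \<open>L k (V (n - k))\<close> with \<open>mabs n \<le> N\<close>
  occurring in the recursion are meaningful.\<close>

definition basic_eigendata ::
    "'u::{real_inner, banach} set \<Rightarrow> ('u \<Rightarrow> 'u) \<Rightarrow> real \<Rightarrow> ('m::finite + nat \<Rightarrow> 'u) \<Rightarrow> 'u ^ 'm \<Rightarrow>
     real ^ 'm ^ 'm \<Rightarrow> 'u ^ 'm \<Rightarrow> bool"
  where "basic_eigendata D L \<alpha> v V0 A0 Z \<longleftrightarrow>
    V0 = (\<chi> i. v (Inl i)) \<and> row_apply L V0 = row_mat V0 A0 \<and>
    inj (($) Z) \<and> independent (range (($) Z)) \<and>
    span (range (($) Z)) = spectral_subspace (adj_dom D L) (adj_op D L) (\<lambda>\<mu>. \<bar>Re \<mu>\<bar> \<le> \<alpha>) \<and>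
    gram Z V0 = mat 1"

definition recursion ::
    "(nat ^ 'M::finite \<Rightarrow> 'u::{real_inner, banach} set) \<Rightarrow> (nat ^ 'M \<Rightarrow> 'u \<Rightarrow> 'u) \<Rightarrow> nat \<Rightarrow>
     'u ^ 'm::finite \<Rightarrow> (nat ^ 'M \<Rightarrow> real ^ 'm ^ 'm) \<Rightarrow> (nat ^ 'M \<Rightarrow> 'u ^ 'm) \<Rightarrow> bool"
  where "recursion D L N Z A V \<longleftrightarrow>
    (\<forall>n k j. mabs n + mabs k \<le> N \<longrightarrow> V n $ j \<in> D k) \<and>
    (\<forall>n. 0 < mabs n \<and> mabs n \<le> N \<longrightarrow>
      A n = (\<Sum>k\<in>{k. 0 < mabs k \<and> k \<le> n}. gram Z (row_apply (L k) (V (n - k)))) \<and>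
      row_apply (L 0) (V n) - row_mat (V n) (A 0) =
        - (\<Sum>k\<in>{k. 0 < mabs k \<and> k \<le> n}. row_apply (L k) (V (n - k)))
        + (\<Sum>k\<in>{k. 0 < mabs k \<and> k \<le> n}. row_mat (V (n - k)) (A k)) \<and>
      gram Z (V n) = 0)"

text \<open>A multinomial in the indeterminate \<open>\<xi>\<close> with coefficients in the field space is represented by
  its coefficient family: \<open>c\<close> stands for the sum of \<open>\<xi>\<close> to the power \<open>n\<close> times \<open>c n\<close>. In particular
  evaluation at \<open>\<xi> = 0\<close> is \<open>c 0\<close>. Coefficient families carry the product topology.\<close>

instantiation "fun" :: (type, real_vector) real_vector
begin

definition scaleR_fun :: "real \<Rightarrow> ('a \<Rightarrow> 'b) \<Rightarrow> 'a \<Rightarrow> 'b"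
  where "scaleR_fun r f = (\<lambda>x. r *\<^sub>R f x)"

instance
  by standard (auto simp: scaleR_fun_def fun_eq_iff algebra_simps)

end

definition multinomials :: "nat \<Rightarrow> (nat ^ 'M::finite \<Rightarrow> 'u::real_vector) set"
  where "multinomials N = {c. \<forall>n. N < mabs n \<longrightarrow> c n = 0}"

definition xi_deriv ::
    "nat ^ 'M::finite \<Rightarrow> (nat ^ 'M \<Rightarrow> 'u::real_vector) \<Rightarrow> nat ^ 'M \<Rightarrow> 'u"
  where "xi_deriv k c = (\<lambda>n. (mfact (n + k) / mfact n) *\<^sub>R c (n + k))"

definition gen_dom ::
    "(nat ^ 'M::finite \<Rightarrow> 'u::real_vector set) \<Rightarrow> nat \<Rightarrow> (nat ^ 'M \<Rightarrow> 'u) set"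
  where "gen_dom D N = {c \<in> multinomials N. \<forall>k n. mabs k \<le> N \<longrightarrow> xi_deriv k c n \<in> D k}"

definition gen_op ::
    "(nat ^ 'M::finite \<Rightarrow> 'u::real_vector \<Rightarrow> 'u) \<Rightarrow> nat \<Rightarrow> (nat ^ 'M \<Rightarrow> 'u) \<Rightarrow> nat ^ 'M \<Rightarrow> 'u"
  where "gen_op L N c = (\<lambda>n. \<Sum>k\<in>{k. mabs k \<le> N}. L k (xi_deriv k c n))"

text \<open>The \<open>j\<close>-th column of the sum over \<open>k \<le> n\<close> of \<open>V (n - k)\<close> times \<open>\<xi>\<close> to the power \<open>k\<close> divided
  by \<open>k!\<close>, and the linear combination of all these columns with coordinates \<open>a\<close>.\<close>

definition gen_column ::
    "(nat ^ 'M::finite \<Rightarrow> 'u::real_vector ^ 'm::finite) \<Rightarrow> nat ^ 'M \<Rightarrow> 'm \<Rightarrow> nat ^ 'M \<Rightarrow> 'u"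
  where "gen_column V n j = (\<lambda>k. if k \<le> n then (1 / mfact k) *\<^sub>R (V (n - k) $ j) else 0)"

definition gen_comb ::
    "(nat ^ 'M::finite \<Rightarrow> 'u::real_vector ^ 'm::finite) \<Rightarrow> nat \<Rightarrow> (nat ^ 'M \<Rightarrow> real ^ 'm) \<Rightarrow>
     nat ^ 'M \<Rightarrow> 'u"
  where "gen_comb V N a = (\<Sum>n\<in>{n. mabs n \<le> N}. \<Sum>j\<in>UNIV. (a n $ j) *\<^sub>R gen_column V n j)"

text \<open>The basis of the stable subspace is given as the linear map \<open>W\<close> that sends a coordinate vector
  in a Banach space to the corresponding combination of basis elements, so that a basis can be
  infinite. The coordinates \<open>a\<close> for the columns are likewise families supported on the
  multi-indices \<open>n\<close> with \<open>mabs n \<le> N\<close>. Completeness of the columns \<open>gen_column V n j\<close> together with \<open>W\<close> means that every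
  multinomial of degree at most \<open>N\<close> has unique coordinates, which depend continuously on it.\<close>

definition complete_basis ::
    "(nat ^ 'M::finite \<Rightarrow> 'u::real_normed_vector ^ 'm::finite) \<Rightarrow> nat \<Rightarrow>
     ('s::banach \<Rightarrow> nat ^ 'M \<Rightarrow> 'u) \<Rightarrow> bool"
  where "complete_basis V N W \<longleftrightarrow> linear W \<and>
    (\<exists>coords. homeomorphism (multinomials N \<times> UNIV) (multinomials N)
      (\<lambda>(a, s). gen_comb V N a + W s) coords)"

text \<open>For \<open>f\<close> the field at a fixed time, this is the weighted average of the derivative of order
  \<open>l\<close> over the segment from \<open>X\<close> to \<open>x\<close> (integral form of the Taylor remainder, \<open>N \<ge> 1\<close>).\<close>

definition taylor_coeff ::
    "nat \<Rightarrow> (real ^ 'M::finite \<Rightarrow> 'u::banach) \<Rightarrow> nat ^ 'M \<Rightarrow> real ^ 'M \<Rightarrow> real ^ 'M \<Rightarrow> 'u"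
  where "taylor_coeff N f l X x = real N *\<^sub>R
    integral {0..1} (\<lambda>s. (1 - s) ^ (N - 1) *\<^sub>R mderiv l f (X + s *\<^sub>R (x - X)))"

definition coupling_coeff ::
    "(nat ^ 'M::finite \<Rightarrow> 'u::banach set) \<Rightarrow> (nat ^ 'M \<Rightarrow> 'u \<Rightarrow> 'u) \<Rightarrow> nat \<Rightarrow>
     (real ^ 'M \<Rightarrow> 'u) \<Rightarrow> real ^ 'M \<Rightarrow> nat ^ 'M \<Rightarrow> 'u"
  where "coupling_coeff D L N f X n =
    (\<Sum>k\<in>{k \<in> op_support D L. 1 \<le> mabs k}. \<Sum>l\<in>{l. mabs l = N \<and> l < n + k}.
      L k (mbinom (k + n) l *\<^sub>R mderiv (k + n - l) (taylor_coeff N f l X) X))"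

definition coupling ::
    "(nat ^ 'M::finite \<Rightarrow> 'u::banach set) \<Rightarrow> (nat ^ 'M \<Rightarrow> 'u \<Rightarrow> 'u) \<Rightarrow> nat \<Rightarrow>
     (real ^ 'M \<Rightarrow> 'u) \<Rightarrow> real ^ 'M \<Rightarrow> nat ^ 'M \<Rightarrow> 'u"
  where "coupling D L N f X =
    (\<lambda>n. if mabs n \<le> N then (1 / mfact n) *\<^sub>R coupling_coeff D L N f X n else 0)"

definition conv :: "(real \<Rightarrow> 's \<Rightarrow> 's) \<Rightarrow> (real \<Rightarrow> 's) \<Rightarrow> real \<Rightarrow> 's::banach"
  where "conv T f t = integral {0..t} (\<lambda>\<tau>. T (t - \<tau>) (f \<tau>))"

text \<open>The second term applies the generator \<open>B\<close> to the convolution, since \<open>B\<close> after \<open>T t\<close> need not be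
  integrable at \<open>t = 0\<close> if \<open>B\<close> is unbounded.\<close>

definition remainder ::
    "'u::{real_inner, banach} ^ 'm::finite \<Rightarrow> (nat ^ 'M::finite \<Rightarrow> real ^ 'm ^ 'm) \<Rightarrow>
     (nat ^ 'M \<Rightarrow> 'u ^ 'm) \<Rightarrow> nat \<Rightarrow> ('s::banach \<Rightarrow> nat ^ 'M \<Rightarrow> 'u) \<Rightarrow> ('s \<Rightarrow> 's) \<Rightarrow>
     (real \<Rightarrow> 's \<Rightarrow> 's) \<Rightarrow> (real \<Rightarrow> nat ^ 'M \<Rightarrow> real ^ 'm) \<Rightarrow> (real \<Rightarrow> 's) \<Rightarrow> real \<Rightarrow> real ^ 'm"
  where "remainder Z A V N W B T rc rs t =
    pair Z (gen_comb V N (rc t) 0) + pair Z (W (B (conv T rs t)) 0) + pair Z (W (rs t) 0)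
    - (\<Sum>n\<in>{n. mabs n \<le> N}. A n *v pair Z (xi_deriv n (W (conv T rs t)) 0))"

end

theory Submission
  imports Defs "HOL-Computational_Algebra.Polynomial"
begin

text \<open>Fix a station \<open>X\<close>. The derivatives of the field at \<open>X\<close> up to order \<open>N\<close>, divided by factorials, are
  the coefficients of a multinomial \<open>c t\<close>, the Taylor polynomial of the field at \<open>X\<close>
  (\<open>gen_field\<close>). Applying up to \<open>N\<close> spatial derivatives to the equation gives
  \<open>c' = gen_op c + coupling\<close> (\<open>gen_field_evolution\<close>). Here the interchange of space and time
  derivatives rests on the symmetry of mixed derivatives (\<open>time_derivative_mderiv\<close>), the interchange
  with the operators on their closedness (\<open>closed_op_mderiv\<close>), and the derivatives of order above \<open>N\<close>
  are exactly the coupling term, by a Beta integral and the Vandermonde identity for multi-indices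
  (\<open>coupling_coeff_eq\<close>).

  In the complete basis write \<open>c = gen_comb V N a + W s\<close>. The recursion for the rows \<open>V\<close> and the
  matrices \<open>A\<close> says that \<open>gen_op\<close> maps the span of the centre columns into itself, acting on the
  coordinates by \<open>centre_op\<close> (\<open>gen_op_gen_comb\<close>), while it acts on the range of \<open>W\<close> through \<open>B\<close>.
  The two coordinates therefore decouple, and the stable one solves \<open>s' = B s + rs\<close>
  (\<open>coordinates_evolution\<close>). Variation of constants turns this into \<open>s t = T t (s 0) + conv T rs t\<close>
  (\<open>variation_of_constants\<close>).

  Finally pair with \<open>Z\<close>, which is dual to \<open>V 0\<close> and annihilates the other rows. Then
  \<open>\<partial>\<^sup>n U = a n + \<langle>Z, \<partial>\<^sup>n W s\<rangle>\<close> at \<open>\<xi> = 0\<close> (\<open>pair_xi_deriv_gen_comb\<close>), and the time derivative of \<open>U\<close> is the sum of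
  \<open>A n *v a n\<close> plus the pairings of \<open>Z\<close> with the coupling and with \<open>W (B s)\<close>. Eliminating \<open>a\<close>
  between the two produces the macroscale equation with \<open>s\<close> in the place where the remainder has
  \<open>conv T rs\<close>. The difference of the two is the orbit \<open>T t (s 0)\<close> seen through two bounded linear
  maps, and it decays at every rate below \<open>\<beta>\<close>.\<close>

section \<open>Derivatives along basis vectors\<close>

text \<open>Space derivatives at a fixed time and the time derivative are both derivatives of one function on
  space-time along basis vectors. Working with \<open>dir_deriv\<close> on a Euclidean space therefore covers
  spatial partial derivatives, the time derivative and their commutation at once.\<close>

definition dir_deriv :: "'a::real_normed_vector \<Rightarrow> ('a \<Rightarrow> 'b::real_normed_vector) \<Rightarrow> 'a \<Rightarrow> 'b"
  where "dir_deriv b f = (\<lambda>x. frechet_derivative f (at x) b)"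

lemma partial_eq_dir_deriv: "partial = (\<lambda>i. dir_deriv (axis i 1))"
  by (simp add: partial_def dir_deriv_def fun_eq_iff)

lemma foldr_partial_eq_dir_deriv: "foldr partial is f = foldr dir_deriv (map (\<lambda>i. axis i 1) is) f"
  by (simp add: foldr_map partial_eq_dir_deriv o_def)

lemma dir_deriv_eqI: "(f has_derivative f') (at x) \<Longrightarrow> dir_deriv b f x = f' b"
  by (simp add: dir_deriv_def frechet_derivative_at[symmetric])

lemma has_derivative_dir_deriv:
  "f differentiable at x \<Longrightarrow> (f has_derivative (\<lambda>b. dir_deriv b f x)) (at x)"
  by (simp add: dir_deriv_def frechet_derivative_works[symmetric])

text \<open>The sets of possible derivatives of \<open>f\<close> and \<open>g\<close> at \<open>x\<close> coincide, so the choice operator behind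
  \<open>frechet_derivative\<close> returns the same value, even if these sets are empty.\<close>

lemma dir_deriv_cong_open:
  assumes "open S" "x \<in> S" "\<And>y. y \<in> S \<Longrightarrow> f y = g y"
  shows "dir_deriv b f x = dir_deriv b g x"
proof -
  have "(f has_derivative f') (at x) \<longleftrightarrow> (g has_derivative f') (at x)" for f'
    using has_derivative_transform_within_open[OF _ assms(1,2), of f f' UNIV g]
      has_derivative_transform_within_open[OF _ assms(1,2), of g f' UNIV f] assms(3) by auto
  then show ?thesis by (simp add: dir_deriv_def frechet_derivative_def)
qed

lemma foldr_dir_deriv_cong_open:
  assumes "open S" "x \<in> S" "\<And>y. y \<in> S \<Longrightarrow> f y = g y"
  shows "foldr dir_deriv bs f x = foldr dir_deriv bs g x"
  using assms(2)
proof (induction bs arbitrary: x)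
  case (Cons b bs)
  show ?case using dir_deriv_cong_open[OF assms(1) Cons.prems Cons.IH] by simp
qed (simp add: assms(3))

lemma Ck_on_Suc_dir_deriv:
  "Ck_on (Suc r) S f \<longleftrightarrow> (\<forall>x\<in>S. f differentiable (at x)) \<and> (\<forall>b\<in>Basis. Ck_on r S (dir_deriv b f))"
  by (simp add: dir_deriv_def)

lemmas Ck_on_simps = Ck_on.simps(1) Ck_on_Suc_dir_deriv

text \<open>The primitive recursion equation would expose \<open>frechet_derivative\<close>; its formulation through
  \<open>dir_deriv\<close> is unfolded on request instead.\<close>

declare Ck_on.simps(2) [simp del]

lemma Ck_on_cong_open:
  assumes "open S" "\<And>y. y \<in> S \<Longrightarrow> f y = g y"
  shows "Ck_on r S f \<Longrightarrow> Ck_on r S g"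
  using assms(2)
proof (induction r arbitrary: f g)
  case 0
  then show ?case by (simp cong: continuous_on_cong)
next
  case (Suc r)
  have "g differentiable at x" if "x \<in> S" for x
  proof (rule differentiableI)
    have "f differentiable at x" using Suc.prems(1) that by (simp add: Ck_on_simps)
    from has_derivative_transform_within_open[OF has_derivative_dir_deriv[OF this] assms(1) that Suc.prems(2)]
    show "(g has_derivative (\<lambda>b. dir_deriv b f x)) (at x)" by simp
  qed
  moreover have "Ck_on r S (dir_deriv b g)" if "b \<in> Basis" for b
  proof (rule Suc.IH)
    show "Ck_on r S (dir_deriv b f)" using Suc.prems(1) that by (simp add: Ck_on_simps)
  qed (rule dir_deriv_cong_open[OF assms(1) _ Suc.prems(2)], auto)
  ultimately show ?case by (simp add: Ck_on_simps)
qed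

lemma Ck_on_SucD: "Ck_on (Suc r) S f \<Longrightarrow> Ck_on r S f"
proof (induction r arbitrary: f)
  case 0
  then show ?case
    by (simp add: continuous_at_imp_continuous_on differentiable_imp_continuous_within Ck_on_simps)
next
  case (Suc r)
  have "Ck_on r S (dir_deriv b f)" if "b \<in> Basis" for b
    using Suc.prems that Ck_on_Suc_dir_deriv[of "Suc r" S f] by (intro Suc.IH) blast
  then show ?case using Suc.prems by (simp only: Ck_on_Suc_dir_deriv) blast
qed

lemma Ck_on_mono: "r \<le> s \<Longrightarrow> Ck_on s S f \<Longrightarrow> Ck_on r S f"
  by (induction s rule: dec_induct) (auto dest: Ck_on_SucD)

lemma Ck_on_subset: "Ck_on r S f \<Longrightarrow> T \<subseteq> S \<Longrightarrow> Ck_on r T f"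
proof (induction r arbitrary: f)
  case 0
  then show ?case using continuous_on_subset by auto
next
  case (Suc r)
  then show ?case by (auto simp: Ck_on_simps)
qed

lemma Ck_on_foldr_dir_deriv:
  "Ck_on (length bs + r) S f \<Longrightarrow> set bs \<subseteq> Basis \<Longrightarrow> Ck_on r S (foldr dir_deriv bs f)"
proof (induction bs arbitrary: r)
  case (Cons b bs)
  then have "Ck_on (Suc r) S (foldr dir_deriv bs f)" by simp
  then show ?case using Cons.prems by (simp add: Ck_on_simps)
qed simp

lemma differentiable_foldr_dir_deriv:
  assumes "Ck_on (Suc (length bs)) S f" "set bs \<subseteq> Basis" "x \<in> S"
  shows "foldr dir_deriv bs f differentiable at x"
  using Ck_on_foldr_dir_deriv[of bs 1 S f] assms by (simp add: Ck_on_simps)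

lemma dir_deriv_add:
  "f differentiable at x \<Longrightarrow> g differentiable at x \<Longrightarrow>
    dir_deriv b (\<lambda>x. f x + g x) x = dir_deriv b f x + dir_deriv b g x"
  by (rule dir_deriv_eqI[OF has_derivative_add[OF has_derivative_dir_deriv has_derivative_dir_deriv]])

lemma dir_deriv_bounded_linear:
  "bounded_linear h \<Longrightarrow> f differentiable at x \<Longrightarrow> dir_deriv b (\<lambda>x. h (f x)) x = h (dir_deriv b f x)"
  by (rule dir_deriv_eqI[OF bounded_linear.has_derivative[OF _ has_derivative_dir_deriv]])

lemma Ck_on_bounded_linear:
  assumes "open S" "bounded_linear h"
  shows "Ck_on r S f \<Longrightarrow> Ck_on r S (\<lambda>x. h (f x))"
proof (induction r arbitrary: f)
  case 0
  then show ?case by (simp add: bounded_linear.continuous_on[OF assms(2)])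
next
  case (Suc r)
  have d: "f differentiable at x" if "x \<in> S" for x
    using Suc.prems that by (simp add: Ck_on_simps)
  have "(\<lambda>x. h (f x)) differentiable at x" if "x \<in> S" for x
    using bounded_linear.has_derivative[OF assms(2) has_derivative_dir_deriv[OF d[OF that]]]
    by (rule differentiableI)
  moreover have "Ck_on r S (dir_deriv b (\<lambda>x. h (f x)))" if "b \<in> Basis" for b
  proof (rule Ck_on_cong_open[OF assms(1), where f = "\<lambda>x. h (dir_deriv b f x)"])
    show "Ck_on r S (\<lambda>x. h (dir_deriv b f x))"
      using Suc.prems that by (intro Suc.IH) (simp add: Ck_on_simps)
  qed (simp add: dir_deriv_bounded_linear[OF assms(2)] d)
  ultimately show ?case by (simp add: Ck_on_simps)
qed

lemma foldr_dir_deriv_bounded_linear: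
  assumes "open S" "bounded_linear h" "Ck_on (length bs) S f" "set bs \<subseteq> Basis" "x \<in> S"
  shows "foldr dir_deriv bs (\<lambda>x. h (f x)) x = h (foldr dir_deriv bs f x)"
  using assms(3-)
proof (induction bs arbitrary: x)
  case (Cons b bs)
  have C: "Ck_on (Suc (length bs)) S f" "set bs \<subseteq> Basis" using Cons.prems by auto
  have "foldr dir_deriv (b # bs) (\<lambda>x. h (f x)) x = dir_deriv b (\<lambda>x. h (foldr dir_deriv bs f x)) x"
    unfolding foldr.simps o_apply
    by (rule dir_deriv_cong_open[OF assms(1) Cons.prems(3) Cons.IH[OF Ck_on_SucD[OF C(1)] C(2)]])
  also have "\<dots> = h (dir_deriv b (foldr dir_deriv bs f) x)"
    by (rule dir_deriv_bounded_linear[OF assms(2) differentiable_foldr_dir_deriv[OF C Cons.prems(3)]])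
  finally show ?case by simp
qed simp

lemma foldr_dir_deriv_add:
  assumes "open S" "Ck_on (length bs) S f" "Ck_on (length bs) S g" "set bs \<subseteq> Basis" "x \<in> S"
  shows "foldr dir_deriv bs (\<lambda>x. f x + g x) x = foldr dir_deriv bs f x + foldr dir_deriv bs g x"
  using assms(2-)
proof (induction bs arbitrary: x)
  case (Cons b bs)
  have C: "Ck_on (Suc (length bs)) S f" "Ck_on (Suc (length bs)) S g" "set bs \<subseteq> Basis"
    using Cons.prems by auto
  have "foldr dir_deriv (b # bs) (\<lambda>x. f x + g x) x
      = dir_deriv b (\<lambda>x. foldr dir_deriv bs f x + foldr dir_deriv bs g x) x"
    unfolding foldr.simps o_apply
    by (rule dir_deriv_cong_open[OF assms(1) Cons.prems(4)
          Cons.IH[OF Ck_on_SucD[OF C(1)] Ck_on_SucD[OF C(2)] C(3)]])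
  also have "\<dots> = foldr dir_deriv (b # bs) f x + foldr dir_deriv (b # bs) g x"
    by (simp add: dir_deriv_add differentiable_foldr_dir_deriv[OF C(1,3) Cons.prems(4)]
        differentiable_foldr_dir_deriv[OF C(2,3) Cons.prems(4)])
  finally show ?case by simp
qed simp

lemma Ck_on_add:
  assumes "open S"
  shows "Ck_on r S f \<Longrightarrow> Ck_on r S g \<Longrightarrow> Ck_on r S (\<lambda>x. f x + g x)"
proof (induction r arbitrary: f g)
  case (Suc r)
  have "Ck_on r S (dir_deriv b (\<lambda>x. f x + g x))" if "b \<in> Basis" for b
  proof (rule Ck_on_cong_open[OF assms, where f = "\<lambda>x. dir_deriv b f x + dir_deriv b g x"])
    show "Ck_on r S (\<lambda>x. dir_deriv b f x + dir_deriv b g x)"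
      using Suc.prems that by (intro Suc.IH) (simp_all add: Ck_on_simps)
  qed (use Suc.prems in \<open>simp add: dir_deriv_add Ck_on_simps\<close>)
  then show ?case using Suc.prems by (simp add: Ck_on_simps)
qed (simp add: continuous_on_add)

lemma Ck_on_const: "Ck_on r S (\<lambda>x. c)"
  by (induction r arbitrary: c) (auto simp: Ck_on.simps(2))

lemma Ck_on_sum:
  assumes "open S" "\<And>k. k \<in> K \<Longrightarrow> Ck_on r S (f k)"
  shows "Ck_on r S (\<lambda>x. \<Sum>k\<in>K. f k x)"
  using assms(2)
  by (induction K rule: infinite_finite_induct) (simp_all add: Ck_on_const Ck_on_add[OF assms(1)])

lemma foldr_dir_deriv_zero: "foldr dir_deriv bs (\<lambda>x. 0) = (\<lambda>x. 0)"
  by (induction bs) (auto simp: dir_deriv_def)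

lemma foldr_dir_deriv_sum:
  assumes "open S" "\<And>k. k \<in> K \<Longrightarrow> Ck_on (length bs) S (f k)" "set bs \<subseteq> Basis" "x \<in> S"
  shows "foldr dir_deriv bs (\<lambda>x. \<Sum>k\<in>K. f k x) x = (\<Sum>k\<in>K. foldr dir_deriv bs (f k) x)"
  using assms(2)
proof (induction K rule: infinite_finite_induct)
  case (insert k K)
  then show ?case
    by (simp add: foldr_dir_deriv_add[OF assms(1) _ Ck_on_sum[OF assms(1)] assms(3,4)])
qed (simp_all add: foldr_dir_deriv_zero)

text \<open>Two applications of the mean value theorem to the second difference over the parallelogram with
  sides \<open>h b\<close> and \<open>h c\<close>. The left-hand side does not change when \<open>b\<close> and \<open>c\<close> are exchanged,
  which is what forces the two mixed derivatives to agree in the limit.\<close>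

lemma second_difference_eq_mixed_derivative:
  fixes f :: "'a::real_normed_vector \<Rightarrow> real"
  assumes "0 < h"
    and f: "\<And>s t. 0 \<le> s \<Longrightarrow> s \<le> h \<Longrightarrow> 0 \<le> t \<Longrightarrow> t \<le> h \<Longrightarrow> f differentiable at (x + s *\<^sub>R b + t *\<^sub>R c)"
    and df: "\<And>s t. 0 \<le> s \<Longrightarrow> s \<le> h \<Longrightarrow> 0 \<le> t \<Longrightarrow> t \<le> h \<Longrightarrow>
      dir_deriv b f differentiable at (x + s *\<^sub>R b + t *\<^sub>R c)"
  obtains s t where "0 < s" "s < h" "0 < t" "t < h"
    "f (x + h *\<^sub>R b + h *\<^sub>R c) - f (x + h *\<^sub>R b) - f (x + h *\<^sub>R c) + f x
      = h * (h * dir_deriv c (dir_deriv b f) (x + s *\<^sub>R b + t *\<^sub>R c))"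
proof -
  have d1: "((\<lambda>s. f (x + s *\<^sub>R b + t *\<^sub>R c)) has_real_derivative dir_deriv b f (x + s *\<^sub>R b + t *\<^sub>R c)) (at s)"
    if "0 \<le> s" "s \<le> h" "0 \<le> t" "t \<le> h" for s t
  proof -
    have "((\<lambda>s. x + s *\<^sub>R b + t *\<^sub>R c) has_derivative (\<lambda>r. r *\<^sub>R b)) (at s)"
      by (auto intro!: derivative_eq_intros)
    from has_derivative_compose[OF this has_derivative_dir_deriv[OF f[OF that]]]
    have "((\<lambda>s. f (x + s *\<^sub>R b + t *\<^sub>R c)) has_derivative
        (\<lambda>r. dir_deriv (r *\<^sub>R b) f (x + s *\<^sub>R b + t *\<^sub>R c))) (at s)" .
    moreover have "dir_deriv (r *\<^sub>R b) f (x + s *\<^sub>R b + t *\<^sub>R c) = dir_deriv b f (x + s *\<^sub>R b + t *\<^sub>R c) * r" for r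
      using linear_frechet_derivative[OF f[OF that]] by (simp add: dir_deriv_def linear_cmul)
    ultimately show ?thesis by (simp add: has_field_derivative_def)
  qed
  have d2: "((\<lambda>t. dir_deriv b f (x + s *\<^sub>R b + t *\<^sub>R c)) has_real_derivative
      dir_deriv c (dir_deriv b f) (x + s *\<^sub>R b + t *\<^sub>R c)) (at t)"
    if "0 \<le> s" "s \<le> h" "0 \<le> t" "t \<le> h" for s t
  proof -
    have "((\<lambda>t. x + s *\<^sub>R b + t *\<^sub>R c) has_derivative (\<lambda>r. r *\<^sub>R c)) (at t)"
      by (auto intro!: derivative_eq_intros)
    from has_derivative_compose[OF this has_derivative_dir_deriv[OF df[OF that]]]
    have "((\<lambda>t. dir_deriv b f (x + s *\<^sub>R b + t *\<^sub>R c)) has_derivative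
        (\<lambda>r. dir_deriv (r *\<^sub>R c) (dir_deriv b f) (x + s *\<^sub>R b + t *\<^sub>R c))) (at t)" .
    moreover have "dir_deriv (r *\<^sub>R c) (dir_deriv b f) (x + s *\<^sub>R b + t *\<^sub>R c)
        = dir_deriv c (dir_deriv b f) (x + s *\<^sub>R b + t *\<^sub>R c) * r" for r
      using linear_frechet_derivative[OF df[OF that]]
      by (simp add: dir_deriv_def[of _ "dir_deriv b f"] linear_cmul)
    ultimately show ?thesis by (simp add: has_field_derivative_def)
  qed
  let ?g = "\<lambda>s. f (x + s *\<^sub>R b + h *\<^sub>R c) - f (x + s *\<^sub>R b + 0 *\<^sub>R c)"
  have "\<exists>s. 0 < s \<and> s < h \<and> ?g h - ?g 0 = (h - 0) *
      (dir_deriv b f (x + s *\<^sub>R b + h *\<^sub>R c) - dir_deriv b f (x + s *\<^sub>R b + 0 *\<^sub>R c))"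
    using assms(1) by (intro MVT2 DERIV_diff d1) auto
  then obtain s where s: "0 < s" "s < h" "?g h - ?g 0 = (h - 0) *
      (dir_deriv b f (x + s *\<^sub>R b + h *\<^sub>R c) - dir_deriv b f (x + s *\<^sub>R b + 0 *\<^sub>R c))" by blast
  have "\<exists>t. 0 < t \<and> t < h \<and>
      dir_deriv b f (x + s *\<^sub>R b + h *\<^sub>R c) - dir_deriv b f (x + s *\<^sub>R b + 0 *\<^sub>R c)
      = (h - 0) * dir_deriv c (dir_deriv b f) (x + s *\<^sub>R b + t *\<^sub>R c)"
    using assms(1) s by (intro MVT2 d2) auto
  then obtain t where "0 < t" "t < h"
      "dir_deriv b f (x + s *\<^sub>R b + h *\<^sub>R c) - dir_deriv b f (x + s *\<^sub>R b + 0 *\<^sub>R c)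
      = (h - 0) * dir_deriv c (dir_deriv b f) (x + s *\<^sub>R b + t *\<^sub>R c)" by blast
  with s show thesis by (intro that[of s t]) auto
qed

lemma dir_deriv_commute_real:
  fixes f :: "'a::euclidean_space \<Rightarrow> real"
  assumes "open S" "Ck_on (Suc (Suc 0)) S f" "b \<in> Basis" "c \<in> Basis" "x \<in> S"
  shows "dir_deriv b (dir_deriv c f) x = dir_deriv c (dir_deriv b f) x"
proof (rule ccontr)
  assume neq: "dir_deriv b (dir_deriv c f) x \<noteq> dir_deriv c (dir_deriv b f) x"
  define e where "e = dist (dir_deriv b (dir_deriv c f) x) (dir_deriv c (dir_deriv b f) x) / 2"
  have e: "0 < e" using neq by (simp add: e_def)
  have cont: "continuous (at x) (dir_deriv b (dir_deriv c f))" "continuous (at x) (dir_deriv c (dir_deriv b f))"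
    using assms by (simp_all add: Ck_on_simps continuous_on_eq_continuous_at)
  obtain d0 where d0: "0 < d0" "ball x d0 \<subseteq> S" using assms open_contains_ball by blast
  obtain d1 where d1: "0 < d1"
    "\<And>y. dist y x < d1 \<Longrightarrow> dist (dir_deriv b (dir_deriv c f) y) (dir_deriv b (dir_deriv c f) x) < e"
    using cont(1) e unfolding continuous_at_eps_delta by blast
  obtain d2 where d2: "0 < d2"
    "\<And>y. dist y x < d2 \<Longrightarrow> dist (dir_deriv c (dir_deriv b f) y) (dir_deriv c (dir_deriv b f) x) < e"
    using cont(2) e unfolding continuous_at_eps_delta by blast
  define h where "h = min d0 (min d1 d2) / 3"
  have h: "0 < h" "2 * h < d0" "2 * h < d1" "2 * h < d2" using d0 d1 d2 by (auto simp: h_def)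
  have near: "dist (x + s *\<^sub>R p + t *\<^sub>R q) x \<le> 2 * h"
    if "0 \<le> s" "s \<le> h" "0 \<le> t" "t \<le> h" "p \<in> Basis" "q \<in> Basis" for s t p q
  proof -
    have "norm (s *\<^sub>R p + t *\<^sub>R q) \<le> norm (s *\<^sub>R p) + norm (t *\<^sub>R q)" by (rule norm_triangle_ineq)
    also have "\<dots> \<le> 2 * h" using that by simp
    finally show ?thesis by (simp add: dist_norm add.assoc)
  qed
  have inS: "x + s *\<^sub>R p + t *\<^sub>R q \<in> S"
    if "0 \<le> s" "s \<le> h" "0 \<le> t" "t \<le> h" "p \<in> Basis" "q \<in> Basis" for s t p q
    using near[OF that] h(2) d0(2) by (force simp: dist_commute)
  have diff: "f differentiable at y" "p \<in> Basis \<Longrightarrow> dir_deriv p f differentiable at y" if "y \<in> S" for y p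
    using assms(2) that by (simp_all add: Ck_on_simps)
  obtain s t where 1: "0 < s" "s < h" "0 < t" "t < h"
    "f (x + h *\<^sub>R b + h *\<^sub>R c) - f (x + h *\<^sub>R b) - f (x + h *\<^sub>R c) + f x
      = h * (h * dir_deriv c (dir_deriv b f) (x + s *\<^sub>R b + t *\<^sub>R c))"
    by (rule second_difference_eq_mixed_derivative[OF h(1), of f x b c]) (simp_all add: diff inS assms(3,4))
  obtain s' t' where 2: "0 < s'" "s' < h" "0 < t'" "t' < h"
    "f (x + h *\<^sub>R c + h *\<^sub>R b) - f (x + h *\<^sub>R c) - f (x + h *\<^sub>R b) + f x
      = h * (h * dir_deriv b (dir_deriv c f) (x + s' *\<^sub>R c + t' *\<^sub>R b))"
    by (rule second_difference_eq_mixed_derivative[OF h(1), of f x c b]) (simp_all add: diff inS assms(3,4))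
  have "x + h *\<^sub>R c + h *\<^sub>R b = x + h *\<^sub>R b + h *\<^sub>R c" by simp
  from 1(5) 2(5)[unfolded this] have "h * (h * dir_deriv c (dir_deriv b f) (x + s *\<^sub>R b + t *\<^sub>R c))
      = h * (h * dir_deriv b (dir_deriv c f) (x + s' *\<^sub>R c + t' *\<^sub>R b))" by linarith
  with h(1) have eq: "dir_deriv c (dir_deriv b f) (x + s *\<^sub>R b + t *\<^sub>R c)
      = dir_deriv b (dir_deriv c f) (x + s' *\<^sub>R c + t' *\<^sub>R b)" by simp
  have "dist (dir_deriv c (dir_deriv b f) (x + s *\<^sub>R b + t *\<^sub>R c)) (dir_deriv c (dir_deriv b f) x) < e"
    using near[of s t b c] 1 h assms by (intro d2) auto
  moreover have "dist (dir_deriv b (dir_deriv c f) (x + s' *\<^sub>R c + t' *\<^sub>R b)) (dir_deriv b (dir_deriv c f) x) < e"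
    using near[of s' t' c b] 2 h assms by (intro d1) auto
  ultimately have "dist (dir_deriv b (dir_deriv c f) x) (dir_deriv c (dir_deriv b f) x)
      < dist (dir_deriv b (dir_deriv c f) x) (dir_deriv c (dir_deriv b f) x)"
    unfolding eq e_def by (rule dist_triangle_half_r[rotated])
  then show False by simp
qed

text \<open>A vector in an inner product space is determined by its inner products, so the real-valued case
  applied to every \<open>z \<bullet> f\<close> suffices.\<close>

lemma dir_deriv_commute:
  fixes f :: "'a::euclidean_space \<Rightarrow> 'b::real_inner"
  assumes "open S" "Ck_on (Suc (Suc 0)) S f" "b \<in> Basis" "c \<in> Basis" "x \<in> S"
  shows "dir_deriv b (dir_deriv c f) x = dir_deriv c (dir_deriv b f) x"
proof -
  have "z \<bullet> dir_deriv b (dir_deriv c f) x = z \<bullet> dir_deriv c (dir_deriv b f) x" for z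
  proof -
    have eq: "dir_deriv p (dir_deriv q (\<lambda>y. z \<bullet> f y)) x = z \<bullet> dir_deriv p (dir_deriv q f) x"
      if "p \<in> Basis" "q \<in> Basis" for p q
      using foldr_dir_deriv_bounded_linear[OF assms(1) bounded_linear_inner_right, of "[p, q]" f x z] assms that
      by (simp)
    show ?thesis
      using dir_deriv_commute_real[OF assms(1) Ck_on_bounded_linear[OF assms(1) bounded_linear_inner_right assms(2)]
          assms(3-5), of z] assms(3,4) by (simp add: eq)
  qed
  then show ?thesis by (metis vector_eq_ldot)
qed

lemma dir_deriv_foldr_commute:
  fixes f :: "'a::euclidean_space \<Rightarrow> 'b::real_inner"
  assumes "open S" "Ck_on (Suc (length bs)) S f" "c \<in> Basis" "set bs \<subseteq> Basis" "x \<in> S"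
  shows "dir_deriv c (foldr dir_deriv bs f) x = foldr dir_deriv bs (dir_deriv c f) x"
  using assms(2,4,5)
proof (induction bs arbitrary: x)
  case (Cons b bs)
  have "dir_deriv c (dir_deriv b (foldr dir_deriv bs f)) x = dir_deriv b (dir_deriv c (foldr dir_deriv bs f)) x"
    using Cons.prems assms(3)
    by (intro dir_deriv_commute[OF assms(1) Ck_on_foldr_dir_deriv]) auto
  also have "\<dots> = dir_deriv b (foldr dir_deriv bs (dir_deriv c f)) x"
  proof (rule dir_deriv_cong_open[OF assms(1) Cons.prems(3)])
    show "dir_deriv c (foldr dir_deriv bs f) y = foldr dir_deriv bs (dir_deriv c f) y" if "y \<in> S" for y
      using Cons.prems(1,2) that by (intro Cons.IH) (auto dest: Ck_on_SucD)
  qed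
  finally show ?case by simp
qed simp

text \<open>Because of this lemma the arbitrary order of differentiation chosen in \<open>mderiv\<close> is harmless.\<close>

lemma foldr_dir_deriv_permute:
  fixes f :: "'a::euclidean_space \<Rightarrow> 'b::real_inner"
  assumes "open S" "Ck_on (length bs) S f" "mset bs = mset cs" "set bs \<subseteq> Basis" "x \<in> S"
  shows "foldr dir_deriv bs f x = foldr dir_deriv cs f x"
  using assms(2-)
proof (induction bs arbitrary: cs x)
  case (Cons b bs)
  have "b \<in> set cs" using Cons.prems(2) by (metis list.set_intros(1) mset_eq_setD)
  then obtain ds es where cs: "cs = ds @ b # es" by (meson split_list)
  have set: "set cs \<subseteq> Basis" using Cons.prems(2,3) by (metis mset_eq_setD)
  have len: "length bs = length (ds @ es)"
    using Cons.prems(2) mset_eq_length[of "b # bs" cs] by (simp add: cs)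
  have "foldr dir_deriv (b # bs) f x = dir_deriv b (foldr dir_deriv (ds @ es) f) x"
    unfolding foldr.simps o_apply
  proof (rule dir_deriv_cong_open[OF assms(1) Cons.prems(4)])
    show "foldr dir_deriv bs f y = foldr dir_deriv (ds @ es) f y" if "y \<in> S" for y
      using Cons.prems(1-3) that by (intro Cons.IH) (auto simp: cs dest: Ck_on_SucD)
  qed
  also have "\<dots> = dir_deriv b (foldr dir_deriv ds (foldr dir_deriv es f)) x" by simp
  also have "\<dots> = foldr dir_deriv ds (dir_deriv b (foldr dir_deriv es f)) x"
    using Cons.prems set len
    by (intro dir_deriv_foldr_commute[OF assms(1) Ck_on_foldr_dir_deriv]) (auto simp: cs add.commute)
  finally show ?case by (simp add: cs)
qed simp

section \<open>Multi-index derivatives, time derivatives and closed operators\<close>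

lemma slice_has_derivative:
  assumes "(F has_derivative F') (at (x, t))"
  shows "((\<lambda>x. F (x, t)) has_derivative (\<lambda>h. F' (h, 0))) (at x)"
proof -
  have "((\<lambda>x. (x, t)) has_derivative (\<lambda>h. (h, 0))) (at x)"
    by (rule has_derivative_Pair[OF has_derivative_ident has_derivative_const])
  from has_derivative_compose[OF this assms] show ?thesis .
qed

lemma dir_deriv_slice:
  assumes "F differentiable at (x, t)"
  shows "dir_deriv b (\<lambda>x. F (x, t)) x = dir_deriv (b, 0) F (x, t)"
  by (rule dir_deriv_eqI[OF slice_has_derivative[OF has_derivative_dir_deriv[OF assms]]])

lemma time_has_vector_derivative:
  fixes F :: "'a::real_normed_vector \<times> real \<Rightarrow> 'b::real_normed_vector"
  assumes "F differentiable at (x, t)"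
  shows "((\<lambda>t. F (x, t)) has_vector_derivative dir_deriv (0, 1) F (x, t)) (at t)"
proof -
  have "((\<lambda>t. (x, t)) has_derivative (\<lambda>h. (0, h))) (at t)"
    by (rule has_derivative_Pair[OF has_derivative_const has_derivative_ident])
  from has_derivative_compose[OF this has_derivative_dir_deriv[OF assms]]
  have "((\<lambda>t. F (x, t)) has_derivative (\<lambda>h. dir_deriv (0, h) F (x, t))) (at t)" .
  moreover have "(\<lambda>h. dir_deriv (0, h) F (x, t)) = (\<lambda>h. h *\<^sub>R dir_deriv (0, 1) F (x, t))"
  proof
    fix h
    have "dir_deriv (h *\<^sub>R (0, 1)) F (x, t) = h *\<^sub>R dir_deriv (0, 1) F (x, t)"
      by (simp only: dir_deriv_def linear_cmul[OF linear_frechet_derivative[OF assms]])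
    moreover have "h *\<^sub>R (0, 1) = (0 :: 'a, h)" by simp
    ultimately show "dir_deriv (0, h) F (x, t) = h *\<^sub>R dir_deriv (0, 1) F (x, t)" by (simp only:)
  qed
  ultimately show ?thesis by (simp only: has_vector_derivative_def)
qed

lemma slice_in_Basis: "b \<in> Basis \<Longrightarrow> (b, 0) \<in> Basis"
  by (simp add: Basis_prod_def)

lemma Ck_on_slice:
  fixes F :: "'a::euclidean_space \<times> real \<Rightarrow> 'b::real_normed_vector"
  assumes "open S"
  shows "Ck_on r (S \<times> UNIV) F \<Longrightarrow> Ck_on r S (\<lambda>x. F (x, t))"
proof (induction r arbitrary: F)
  case 0
  have "continuous_on S (\<lambda>x. (x, t))" by (intro continuous_intros)
  from continuous_on_compose2[OF 0[unfolded Ck_on.simps] this] show ?case by auto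
next
  case (Suc r)
  have d: "F differentiable at (x, t)" if "x \<in> S" for x using Suc.prems that by (simp add: Ck_on_simps)
  have "Ck_on r S (dir_deriv b (\<lambda>x. F (x, t)))" if "b \<in> Basis" for b
  proof (rule Ck_on_cong_open[OF assms])
    show "Ck_on r S (\<lambda>x. dir_deriv (b, 0) F (x, t))"
      using Suc.prems[unfolded Ck_on_Suc_dir_deriv] slice_in_Basis[OF that] by (intro Suc.IH) blast
  qed (simp add: dir_deriv_slice d)
  moreover have "(\<lambda>x. F (x, t)) differentiable at x" if "x \<in> S" for x
    using slice_has_derivative[OF has_derivative_dir_deriv[OF d[OF that]]] by (rule differentiableI)
  ultimately show ?case by (simp add: Ck_on_simps)
qed

text \<open>Differentiating at a frozen time is differentiating the joint function along spatial basis
  vectors; this is how smoothness in space-time yields facts about \<open>mderiv\<close> at each time.\<close>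

lemma foldr_dir_deriv_slice:
  fixes F :: "'a::euclidean_space \<times> real \<Rightarrow> 'b::real_normed_vector"
  assumes "open S" "Ck_on (length bs) (S \<times> UNIV) F" "set bs \<subseteq> Basis" "x \<in> S"
  shows "foldr dir_deriv bs (\<lambda>x. F (x, t)) x = foldr dir_deriv (map (\<lambda>b. (b, 0)) bs) F (x, t)"
  using assms(2-)
proof (induction bs arbitrary: x)
  case (Cons b bs)
  have C: "Ck_on (Suc (length bs)) (S \<times> UNIV) F" "set bs \<subseteq> Basis" using Cons.prems by auto
  let ?G = "foldr dir_deriv (map (\<lambda>b. (b, 0)) bs) F"
  have "foldr dir_deriv (b # bs) (\<lambda>x. F (x, t)) x = dir_deriv b (\<lambda>x. ?G (x, t)) x"
    unfolding foldr.simps o_apply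
    by (rule dir_deriv_cong_open[OF assms(1) Cons.prems(3) Cons.IH[OF Ck_on_SucD[OF C(1)] C(2)]])
  also have "\<dots> = dir_deriv (b, 0) ?G (x, t)"
  proof (rule dir_deriv_slice[OF differentiable_foldr_dir_deriv])
    show "Ck_on (Suc (length (map (\<lambda>b. (b, 0::real)) bs))) (S \<times> UNIV) F" using C by simp
    show "set (map (\<lambda>b. (b, 0::real)) bs) \<subseteq> Basis" using C(2) slice_in_Basis by auto
    show "(x, t) \<in> S \<times> UNIV" using Cons.prems by simp
  qed
  finally show ?case by simp
qed simp

text \<open>A name for the list chosen inside \<open>mderiv\<close>, of which only the multiplicities of its entries matter.\<close>

definition mlist :: "nat ^ 'M::finite \<Rightarrow> 'M list"
  where "mlist k = (SOME is. \<forall>i. count_list is i = k $ i)"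

lemma count_list_mlist: "count_list (mlist k) i = k $ i"
proof -
  obtain xs where "mset xs = Abs_multiset (($) k)" using ex_mset by blast
  then have "count_list xs i = k $ i" for i
    using count_mset[of xs i] by (simp add: count_Abs_multiset)
  then show ?thesis unfolding mlist_def
    using someI[of "\<lambda>is. \<forall>i. count_list is i = k $ i" xs] by blast
qed

lemma length_eq_sum_count: "length (xs :: 'a::finite list) = (\<Sum>i\<in>UNIV. count_list xs i)"
  by (rule sum_count_set[symmetric]) auto

lemma length_mlist: "length (mlist k) = mabs k"
  by (simp add: length_eq_sum_count count_list_mlist mabs_def)

definition mdirs :: "nat ^ 'M::finite \<Rightarrow> (real ^ 'M) list"
  where "mdirs k = map (\<lambda>i. axis i 1) (mlist k)"

lemma mdirs: "length (mdirs k) = mabs k" "set (mdirs k) \<subseteq> Basis"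
  by (auto simp: mdirs_def length_mlist axis_in_Basis_iff)

lemma mderiv_eq_foldr: "mderiv k f = foldr dir_deriv (mdirs k) f"
  by (simp add: mderiv_def mlist_def[symmetric] mdirs_def foldr_partial_eq_dir_deriv)

lemma mdirs_0: "mdirs 0 = []"
  using mdirs(1)[of 0] by (simp add: mabs_def)

lemma mderiv_0: "mderiv 0 f = f"
  by (simp add: mderiv_eq_foldr mdirs_0)

lemma mabs_add: "mabs (k + l) = mabs k + mabs l"
  by (simp add: mabs_def sum.distrib)

lemma mset_mdirs_add: "mset (mdirs (k + l)) = mset (mdirs k @ mdirs l)"
proof -
  have "mset (mlist (k + l)) = mset (mlist k @ mlist l)"
    by (rule multiset_eqI) (simp add: count_mset count_list_mlist)
  then show ?thesis by (simp add: mdirs_def)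
qed

lemma mderiv_add:
  fixes f :: "real ^ 'M::finite \<Rightarrow> 'b::real_inner"
  assumes "open S" "Ck_on (mabs k + mabs l) S f" "x \<in> S"
  shows "mderiv k (mderiv l f) x = mderiv (k + l) f x"
proof -
  have "Ck_on (length (mdirs (k + l))) S f" using assms(2) by (simp add: mdirs(1) mabs_add)
  from foldr_dir_deriv_permute[OF assms(1) this mset_mdirs_add mdirs(2) assms(3)]
  show ?thesis by (simp add: mderiv_eq_foldr)
qed

lemma Ck_on_mderiv: "Ck_on (mabs k + r) S f \<Longrightarrow> Ck_on r S (mderiv k f)"
  using Ck_on_foldr_dir_deriv[OF _ mdirs(2), of k r S f] by (simp add: mderiv_eq_foldr mdirs(1))

lemma mderiv_cong_open:
  assumes "open S" "x \<in> S" "\<And>y. y \<in> S \<Longrightarrow> f y = g y"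
  shows "mderiv k f x = mderiv k g x"
  unfolding mderiv_eq_foldr by (rule foldr_dir_deriv_cong_open[OF assms])

lemma mderiv_bounded_linear:
  assumes "open S" "bounded_linear h" "Ck_on (mabs k) S f" "x \<in> S"
  shows "mderiv k (\<lambda>x. h (f x)) x = h (mderiv k f x)"
  unfolding mderiv_eq_foldr
  by (rule foldr_dir_deriv_bounded_linear[OF assms(1,2) _ mdirs(2) assms(4)]) (simp add: mdirs assms(3))

lemma mderiv_sum:
  assumes "open S" "\<And>j. j \<in> K \<Longrightarrow> Ck_on (mabs k) S (f j)" "x \<in> S"
  shows "mderiv k (\<lambda>x. \<Sum>j\<in>K. f j x) x = (\<Sum>j\<in>K. mderiv k (f j) x)"
  unfolding mderiv_eq_foldr
  by (rule foldr_dir_deriv_sum[OF assms(1) _ mdirs(2) assms(3)]) (simp add: mdirs assms(2))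

text \<open>The time derivative is one more direction \<open>(0, 1)\<close> of the joint function, hence it can be moved
  past all spatial derivatives as soon as one additional order of smoothness is available.\<close>

lemma time_derivative_mderiv:
  fixes u :: "real ^ 'M::finite \<Rightarrow> real \<Rightarrow> 'b::real_inner"
  assumes "open S" "Ck_on (Suc (mabs n)) (S \<times> UNIV) (\<lambda>(x, t). u x t)"
    and u': "\<And>x. x \<in> S \<Longrightarrow> ((\<lambda>t. u x t) has_vector_derivative u' x) (at t)"
    and "x \<in> S"
  shows "((\<lambda>t. mderiv n (\<lambda>x. u x t) x) has_vector_derivative mderiv n u' x) (at t)"
proof -
  let ?F = "\<lambda>(x, t). u x t" and ?bs = "map (\<lambda>b. (b, 0::real)) (mdirs n)"
  have bs: "length ?bs = mabs n" "set ?bs \<subseteq> Basis" using mdirs[of n] slice_in_Basis by auto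
  have oT: "open (S \<times> (UNIV::real set))" using assms(1) by (simp add: open_Times)
  have slice: "mderiv n (\<lambda>x. G (x, t)) x = foldr dir_deriv ?bs G (x, t)"
    if "Ck_on (mabs n) (S \<times> UNIV) G" for G :: "_ \<Rightarrow> 'b" and t
    using foldr_dir_deriv_slice[OF assms(1) _ mdirs(2) assms(4), of n G t] that
    by (simp add: mderiv_eq_foldr mdirs(1))
  have d: "?F differentiable at (y, t)" if "y \<in> S" for y
    using assms(2) that by (simp add: Ck_on_simps)
  have T: "(0, 1) \<in> (Basis :: ((real ^ 'M) \<times> real) set)" by (simp add: Basis_prod_def)
  have "((\<lambda>t. foldr dir_deriv ?bs ?F (x, t)) has_vector_derivative
      dir_deriv (0, 1) (foldr dir_deriv ?bs ?F) (x, t)) (at t)"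
    using differentiable_foldr_dir_deriv[of ?bs "S \<times> UNIV" ?F "(x, t)"] assms bs
    by (intro time_has_vector_derivative) simp
  also have "dir_deriv (0, 1) (foldr dir_deriv ?bs ?F) (x, t) = foldr dir_deriv ?bs (dir_deriv (0, 1) ?F) (x, t)"
    using assms bs T by (intro dir_deriv_foldr_commute[OF oT]) auto
  also have "\<dots> = mderiv n (\<lambda>x. dir_deriv (0, 1) ?F (x, t)) x"
    using assms(2) T by (intro slice[symmetric]) (simp add: Ck_on_simps)
  also have "\<dots> = mderiv n u' x"
  proof (rule mderiv_cong_open[OF assms(1,4)])
    show "dir_deriv (0, 1) ?F (y, t) = u' y" if "y \<in> S" for y
    proof (rule vector_derivative_unique_at)
      show "((\<lambda>t. u y t) has_vector_derivative dir_deriv (0, 1) ?F (y, t)) (at t)"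
        using time_has_vector_derivative[OF d[OF that]] by simp
    qed (rule u'[OF that])
  qed
  also have "(\<lambda>t. foldr dir_deriv ?bs ?F (x, t)) = (\<lambda>t. mderiv n (\<lambda>x. u x t) x)"
    using slice[OF Ck_on_SucD[OF assms(2)]] by (simp add: fun_eq_iff)
  finally show ?thesis .
qed

lemma has_vector_derivative_within_quotient:
  "(f has_vector_derivative f') (at x within S) \<longleftrightarrow>
    ((\<lambda>y. (f y - f x) /\<^sub>R (y - x)) \<longlongrightarrow> f') (at x within S)"
proof -
  have "norm ((1 / norm (y - x)) *\<^sub>R (f y - (f x + (y - x) *\<^sub>R f'))) = norm ((f y - f x) /\<^sub>R (y - x) - f')"
    if "y \<noteq> x" for y
  proof -
    have "(f y - f x) /\<^sub>R (y - x) - f' = (1 / (y - x)) *\<^sub>R (f y - (f x + (y - x) *\<^sub>R f'))"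
    proof -
      have "(1 / (y - x)) *\<^sub>R ((y - x) *\<^sub>R f') = f'" using that by simp
      then show ?thesis by (simp add: scaleR_diff_right scaleR_add_right divide_inverse algebra_simps
            del: scaleR_scaleR)
    qed
    then show ?thesis by (simp add: abs_divide)
  qed
  then have "((\<lambda>y. norm ((1 / norm (y - x)) *\<^sub>R (f y - (f x + (y - x) *\<^sub>R f')))) \<longlongrightarrow> 0) (at x within S)
      \<longleftrightarrow> ((\<lambda>y. norm ((f y - f x) /\<^sub>R (y - x) - f')) \<longlongrightarrow> 0) (at x within S)"
    by (intro tendsto_cong) (simp add: eventually_at_filter)
  then show ?thesis
    unfolding has_vector_derivative_def has_derivative_within tendsto_norm_zero_iff
    by (simp add: LIM_zero_iff bounded_linear_scaleR_left)
qed

lemma linear_op_diff: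
  assumes "linear_op D L" "x \<in> D" "y \<in> D"
  shows "x - y \<in> D" "L (x - y) = L x - L y"
proof -
  have "subspace D" using assms by (simp add: linear_op_def)
  then have m: "(-1) *\<^sub>R y \<in> D" using assms(3) by (rule subspace_scale)
  show "x - y \<in> D" using \<open>subspace D\<close> assms(2,3) by (rule subspace_diff)
  have "L (x + (-1) *\<^sub>R y) = L x + (-1) *\<^sub>R L y" using assms m unfolding linear_op_def by metis
  then show "L (x - y) = L x - L y" by simp
qed

lemma linear_op_scaleR:
  assumes "linear_op D L" "x \<in> D"
  shows "c *\<^sub>R x \<in> D" "L (c *\<^sub>R x) = c *\<^sub>R L x"
  using assms by (auto simp: linear_op_def subspace_scale)

lemma linear_op_scaleR_diff:
  assumes "linear_op D L" "x \<in> D" "y \<in> D"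
  shows "c *\<^sub>R (x - y) \<in> D" "L (c *\<^sub>R (x - y)) = c *\<^sub>R (L x - L y)"
  using linear_op_diff[OF assms] linear_op_scaleR[OF assms(1)] by auto

lemma linear_op_zero:
  assumes "linear_op D L"
  shows "0 \<in> D" "L 0 = 0"
proof -
  show "0 \<in> D" using assms by (simp add: linear_op_def subspace_0)
  from linear_op_scaleR(2)[OF assms this, of 0] show "L 0 = 0" by simp
qed

lemma linear_op_sum:
  assumes "linear_op D L" "\<And>i. i \<in> I \<Longrightarrow> f i \<in> D"
  shows "sum f I \<in> D \<and> L (sum f I) = (\<Sum>i\<in>I. L (f i))"
  using assms(2)
proof (induction I rule: infinite_finite_induct)
  case (insert i I)
  then show ?case using assms(1) by (simp add: linear_op_def subspace_add)
qed (simp_all add: linear_op_zero[OF assms(1)])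

text \<open>The difference quotients of \<open>f\<close> lie in the domain, and both they and their images converge;
  closedness of the graph puts the limit pair into the graph. This replaces boundedness when an
  unbounded operator has to be interchanged with differentiation.\<close>

lemma closed_op_dir_deriv:
  fixes f :: "'a::real_normed_vector \<Rightarrow> 'b::real_normed_vector"
  assumes "closed_op D L" "open S" "x \<in> S"
    and f: "\<And>y. y \<in> S \<Longrightarrow> f y \<in> D" "f differentiable at x" "(\<lambda>y. L (f y)) differentiable at x"
  shows "dir_deriv b f x \<in> D" "L (dir_deriv b f x) = dir_deriv b (\<lambda>y. L (f y)) x"
proof -
  have D: "linear_op D L" and cl: "closed {(v, L v) | v. v \<in> D}" using assms(1) by (auto simp: closed_op_def)
  have lim: "((\<lambda>h. (g (x + h *\<^sub>R b) - g x) /\<^sub>R h) \<longlongrightarrow> dir_deriv b g x) (at 0)"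
    if g: "g differentiable at x" for g :: "_ \<Rightarrow> 'b"
  proof -
    have "((\<lambda>h. x + h *\<^sub>R b) has_derivative (\<lambda>h. h *\<^sub>R b)) (at 0)" by (auto intro!: derivative_eq_intros)
    moreover have "(g has_derivative (\<lambda>h. dir_deriv h g x)) (at (x + 0 *\<^sub>R b))"
      using has_derivative_dir_deriv[OF g] by simp
    ultimately have "((\<lambda>h. g (x + h *\<^sub>R b)) has_derivative (\<lambda>h. dir_deriv (h *\<^sub>R b) g x)) (at 0)"
      by (rule has_derivative_compose)
    moreover have "dir_deriv (h *\<^sub>R b) g x = h *\<^sub>R dir_deriv b g x" for h
      using linear_cmul[OF linear_frechet_derivative[OF g]] by (simp add: dir_deriv_def)
    ultimately have "((\<lambda>h. g (x + h *\<^sub>R b)) has_vector_derivative dir_deriv b g x) (at 0)"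
      by (simp add: has_vector_derivative_def)
    then show ?thesis by (simp add: has_vector_derivative_within_quotient)
  qed
  let ?q = "\<lambda>h. (f (x + h *\<^sub>R b) - f x) /\<^sub>R h"
  have "\<forall>\<^sub>F h in at 0. (?q h, (L (f (x + h *\<^sub>R b)) - L (f x)) /\<^sub>R h) \<in> {(v, L v) | v. v \<in> D}"
  proof -
    have "((\<lambda>h. x + h *\<^sub>R b) \<longlongrightarrow> x + 0 *\<^sub>R b) (at 0)" by (intro tendsto_intros)
    then have "\<forall>\<^sub>F h in at 0. x + h *\<^sub>R b \<in> S" using assms(2,3) topological_tendstoD by fastforce
    then show ?thesis
    proof eventually_elim
      case (elim h)
      have "f (x + h *\<^sub>R b) \<in> D" "f x \<in> D" using f(1) elim assms(3) by auto
      then show ?case using linear_op_scaleR_diff[OF D] by auto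
    qed
  qed
  from Lim_in_closed_set[OF cl this _ tendsto_Pair[OF lim[OF f(2)] lim[OF f(3)]]]
  show "dir_deriv b f x \<in> D" "L (dir_deriv b f x) = dir_deriv b (\<lambda>y. L (f y)) x" by auto
qed

lemma closed_op_foldr_dir_deriv:
  assumes "closed_op D L" "open S" "Ck_on (length bs) S f" "Ck_on (length bs) S (\<lambda>y. L (f y))"
    "set bs \<subseteq> Basis" "\<And>y. y \<in> S \<Longrightarrow> f y \<in> D" "x \<in> S"
  shows "foldr dir_deriv bs f x \<in> D \<and> L (foldr dir_deriv bs f x) = foldr dir_deriv bs (\<lambda>y. L (f y)) x"
  using assms(3-5,7)
proof (induction bs arbitrary: x)
  case (Cons b bs)
  have C: "Ck_on (Suc (length bs)) S f" "Ck_on (Suc (length bs)) S (\<lambda>y. L (f y))" "set bs \<subseteq> Basis"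
    using Cons.prems by auto
  note IH = Cons.IH[OF Ck_on_SucD[OF C(1)] Ck_on_SucD[OF C(2)] C(3)]
  have "(\<lambda>y. L (foldr dir_deriv bs f y)) differentiable at x"
  proof (rule differentiableI[OF has_derivative_transform_within_open])
    show "(foldr dir_deriv bs (\<lambda>y. L (f y)) has_derivative
        (\<lambda>b. dir_deriv b (foldr dir_deriv bs (\<lambda>y. L (f y))) x)) (at x)"
      by (rule has_derivative_dir_deriv[OF differentiable_foldr_dir_deriv[OF C(2,3) Cons.prems(4)]])
    show "foldr dir_deriv bs (\<lambda>y. L (f y)) y = L (foldr dir_deriv bs f y)" if "y \<in> S" for y
      using IH[OF that] by simp
  qed (use assms(2) Cons.prems(4) in auto)
  note cl = closed_op_dir_deriv[OF assms(1,2) Cons.prems(4) conjunct1[OF IH]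
      differentiable_foldr_dir_deriv[OF C(1,3) Cons.prems(4)] this, where b = b]
  have "dir_deriv b (\<lambda>y. L (foldr dir_deriv bs f y)) x = dir_deriv b (foldr dir_deriv bs (\<lambda>y. L (f y))) x"
    by (rule dir_deriv_cong_open[OF assms(2) Cons.prems(4) conjunct2[OF IH]])
  with cl show ?case by simp
qed (simp add: assms(6))

lemma closed_op_mderiv:
  assumes "closed_op D L" "open S" "Ck_on (mabs k) S f" "Ck_on (mabs k) S (\<lambda>y. L (f y))"
    "\<And>y. y \<in> S \<Longrightarrow> f y \<in> D" "x \<in> S"
  shows "mderiv k f x \<in> D" "L (mderiv k f x) = mderiv k (\<lambda>y. L (f y)) x"
  using closed_op_foldr_dir_deriv[OF assms(1,2) _ _ mdirs(2)[of k] assms(5,6)] assms(3,4)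
  by (simp_all add: mderiv_eq_foldr mdirs(1))

section \<open>Averages over segments and the coupling term\<close>

text \<open>With the weight \<open>N * (1 - s) ^ (N - 1)\<close> and \<open>g\<close> a derivative of order \<open>N\<close> this is the
  integral form of the Taylor remainder coefficient. A general weight is needed because every
  differentiation in \<open>x\<close> multiplies the weight by \<open>s\<close>.\<close>

definition segment_average ::
    "(real \<Rightarrow> real) \<Rightarrow> ('a::real_normed_vector \<Rightarrow> 'b::banach) \<Rightarrow> 'a \<Rightarrow> 'a \<Rightarrow> 'b"
  where "segment_average w g X x = integral {0..1} (\<lambda>s. w s *\<^sub>R g (X + s *\<^sub>R (x - X)))"

lemma segment_in_ball:
  fixes X :: "'a::real_normed_vector"
  assumes "x \<in> ball X e" "0 \<le> s" "s \<le> 1"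
  shows "X + s *\<^sub>R (x - X) \<in> ball X e"
proof -
  have "norm (s *\<^sub>R (x - X)) \<le> norm (x - X)" using assms by (simp add: mult_left_le_one_le)
  also have "\<dots> < e" using assms by (simp add: dist_norm norm_minus_commute)
  finally show ?thesis by (simp add: dist_norm)
qed

text \<open>Leibniz' rule: the chain rule contributes the factor \<open>s\<close>, and continuity of the first
  derivatives of \<open>g\<close> makes the derivative of the integrand jointly continuous as a bounded linear
  map.\<close>

lemma dir_deriv_segment_average:
  fixes g :: "'a::euclidean_space \<Rightarrow> 'b::banach"
  assumes g: "Ck_on (Suc 0) (ball X e) g" and w: "continuous_on {0..1} w" and x: "x \<in> ball X e"
  shows "segment_average w g X differentiable at x"
    "dir_deriv b (segment_average w g X) x = segment_average (\<lambda>s. s * w s) (dir_deriv b g) X x"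
proof -
  let ?p = "\<lambda>s x. X + s *\<^sub>R (x - X)"
  define g' where "g' x s = Blinfun (\<lambda>h. (s * w s) *\<^sub>R dir_deriv h g (?p s x))" for x s
  have g_diff: "g differentiable at y" if "y \<in> ball X e" for y
    using g that by (simp add: Ck_on_simps)
  have g'_apply: "blinfun_apply (g' y s) = (\<lambda>h. (s * w s) *\<^sub>R dir_deriv h g (?p s y))"
    if "y \<in> ball X e" "s \<in> {0..1}" for y s
  proof -
    have "bounded_linear (\<lambda>h. dir_deriv h g (?p s y))"
      using has_derivative_bounded_linear[OF has_derivative_dir_deriv[OF g_diff[OF segment_in_ball]]] that by simp
    then show ?thesis
      unfolding g'_def by (intro bounded_linear_Blinfun_apply bounded_linear_scaleR_right[THEN bounded_linear_compose])
  qed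
  have deriv: "((\<lambda>x. w s *\<^sub>R g (?p s x)) has_derivative blinfun_apply (g' y s)) (at y within ball X e)"
    if y: "y \<in> ball X e" and s: "s \<in> cbox 0 1" for y s
  proof -
    have d: "g differentiable at (?p s y)" using g_diff[OF segment_in_ball[OF y]] s by simp
    have "((\<lambda>x. ?p s x) has_derivative (\<lambda>h. s *\<^sub>R h)) (at y)"
      by (auto intro!: derivative_eq_intros)
    from has_derivative_compose[OF this has_derivative_dir_deriv[OF d]]
    have "((\<lambda>x. g (?p s x)) has_derivative (\<lambda>h. dir_deriv (s *\<^sub>R h) g (?p s y))) (at y)" .
    then have "((\<lambda>x. w s *\<^sub>R g (?p s x)) has_derivative (\<lambda>h. w s *\<^sub>R dir_deriv (s *\<^sub>R h) g (?p s y))) (at y)"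
      by (rule has_derivative_scaleR_right)
    moreover have "(\<lambda>h. w s *\<^sub>R dir_deriv (s *\<^sub>R h) g (?p s y)) = blinfun_apply (g' y s)"
    proof
      fix h
      have "dir_deriv (s *\<^sub>R h) g (?p s y) = s *\<^sub>R dir_deriv h g (?p s y)"
        unfolding dir_deriv_def by (rule linear_cmul[OF linear_frechet_derivative[OF d]])
      then show "w s *\<^sub>R dir_deriv (s *\<^sub>R h) g (?p s y) = blinfun_apply (g' y s) h"
        using y s by (simp add: g'_apply mult.commute)
    qed
    ultimately show ?thesis by (simp add: has_derivative_at_withinI)
  qed
  have p_cont: "continuous_on (ball X e \<times> {0..1}) (\<lambda>(y, s). ?p s y)"
    by (auto simp: split_beta intro!: continuous_intros)
  have p_im: "(\<lambda>(y, s). ?p s y) ` (ball X e \<times> {0..1}) \<subseteq> ball X e"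
    using segment_in_ball by fastforce
  have w_cont: "continuous_on (ball X e \<times> {0..1}) (\<lambda>p. w (snd p))"
    by (rule continuous_on_compose2[OF w]) (auto intro!: continuous_intros)
  have cont: "continuous_on (ball X e \<times> cbox 0 1) (\<lambda>(y, s). g' y s)"
  proof (rule continuous_on_blinfun_componentwise)
    fix i :: 'a assume "i \<in> Basis"
    then have "continuous_on (ball X e) (dir_deriv i g)" using g by (simp add: Ck_on_simps)
    from continuous_on_compose2[OF this p_cont p_im]
    have "continuous_on (ball X e \<times> {0..1}) (\<lambda>q. dir_deriv i g (case q of (y, s) \<Rightarrow> ?p s y))" .
    then have "continuous_on (ball X e \<times> {0..1})
        (\<lambda>q. (snd q * w (snd q)) *\<^sub>R dir_deriv i g (case q of (y, s) \<Rightarrow> ?p s y))"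
      by (intro continuous_intros w_cont)
    then show "continuous_on (ball X e \<times> cbox 0 1) (\<lambda>q. blinfun_apply (case q of (y, s) \<Rightarrow> g' y s) i)"
      by (subst continuous_on_cong[OF refl, where g = "\<lambda>q. (snd q * w (snd q)) *\<^sub>R dir_deriv i g (case q of (y, s) \<Rightarrow> ?p s y)"])
        (auto simp: g'_apply)
  qed
  have int: "(\<lambda>s. w s *\<^sub>R g (?p s y)) integrable_on cbox 0 1" if "y \<in> ball X e" for y
  proof (rule integrable_continuous)
    have "continuous_on (ball X e) g" using Ck_on_SucD[OF g] by simp
    then have "continuous_on {0..1} (\<lambda>s. g (?p s y))"
      by (rule continuous_on_compose2) (use segment_in_ball[OF that] in \<open>auto intro!: continuous_intros\<close>)
    then show "continuous_on (cbox 0 1) (\<lambda>s. w s *\<^sub>R g (?p s y))" using w by (simp add: continuous_on_scaleR)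
  qed
  have "((\<lambda>x. integral (cbox 0 1) (\<lambda>s. w s *\<^sub>R g (?p s x))) has_derivative
      blinfun_apply (integral (cbox 0 1) (g' x))) (at x within ball X e)"
    by (rule leibniz_rule[OF deriv int cont x convex_ball])
  then have D: "(segment_average w g X has_derivative blinfun_apply (integral {0..1} (g' x))) (at x)"
    using x by (simp add: segment_average_def[abs_def] at_within_open[of x "ball X e"])
  then show "segment_average w g X differentiable at x" by (rule differentiableI)
  have "continuous_on {0..1} (\<lambda>s. case (x, s) of (y, s) \<Rightarrow> g' y s)"
    by (rule continuous_on_compose2[OF cont, of "{0..1}" "Pair x"]) (use x in \<open>auto intro!: continuous_intros\<close>)
  then have "g' x integrable_on {0..1}" by (simp add: integrable_continuous_interval)
  then have "blinfun_apply (integral {0..1} (g' x)) b = integral {0..1} (\<lambda>s. blinfun_apply (g' x s) b)"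
    by (rule blinfun_apply_integral)
  also have "\<dots> = segment_average (\<lambda>s. s * w s) (dir_deriv b g) X x"
    unfolding segment_average_def by (intro integral_cong) (simp add: g'_apply[OF x])
  finally show "dir_deriv b (segment_average w g X) x = segment_average (\<lambda>s. s * w s) (dir_deriv b g) X x"
    using dir_deriv_eqI[OF D] by simp
qed

lemma foldr_dir_deriv_segment_average:
  fixes g :: "'a::euclidean_space \<Rightarrow> 'b::banach"
  assumes "Ck_on (length bs) (ball X e) g" "continuous_on {0..1} w" "set bs \<subseteq> Basis" "x \<in> ball X e"
  shows "foldr dir_deriv bs (segment_average w g X) x
    = segment_average (\<lambda>s. s ^ length bs * w s) (foldr dir_deriv bs g) X x"
  using assms(1,3,4)
proof (induction bs arbitrary: x)
  case (Cons b bs)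
  let ?w = "\<lambda>s. s ^ length bs * w s"
  have C: "Ck_on (Suc (length bs)) (ball X e) g" "set bs \<subseteq> Basis" using Cons.prems by auto
  have "foldr dir_deriv (b # bs) (segment_average w g X) x
      = dir_deriv b (segment_average ?w (foldr dir_deriv bs g) X) x"
    unfolding foldr.simps o_apply
    by (rule dir_deriv_cong_open[OF open_ball Cons.prems(3) Cons.IH[OF Ck_on_SucD[OF C(1)] C(2)]])
  also have "\<dots> = segment_average (\<lambda>s. s * ?w s) (dir_deriv b (foldr dir_deriv bs g)) X x"
  proof (rule dir_deriv_segment_average(2)[OF _ _ Cons.prems(3)])
    show "Ck_on (Suc 0) (ball X e) (foldr dir_deriv bs g)"
      using Ck_on_foldr_dir_deriv[of bs "Suc 0"] C by simp
    show "continuous_on {0..1} ?w" using assms(2) by (intro continuous_intros)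
  qed
  finally show ?case by (simp add: mult.assoc)
qed simp

text \<open>Induction on \<open>p\<close> through integration by parts, which trades one factor \<open>1 - s\<close> for one
  factor \<open>s\<close>.\<close>

lemma has_integral_Beta_nat:
  "((\<lambda>s. s ^ j * (1 - s) ^ p) has_integral (fact j * fact p / fact (j + p + 1))) {0..1::real}"
proof (induction p arbitrary: j)
  case 0
  have "((\<lambda>s. s ^ j) has_integral (1 ^ Suc j / real (Suc j) - 0 ^ Suc j / real (Suc j))) {0..1::real}"
  proof (rule fundamental_theorem_of_calculus)
    fix s :: real
    have "((\<lambda>s. s ^ Suc j / real (Suc j)) has_real_derivative s ^ j) (at s within {0..1})"
      using DERIV_cdivide[OF DERIV_pow[of "Suc j" s "{0..1}"], of "real (Suc j)"] by (simp del: of_nat_Suc)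
    then show "((\<lambda>s. s ^ Suc j / real (Suc j)) has_vector_derivative s ^ j) (at s within {0..1})"
      by (simp add: has_real_derivative_iff_has_vector_derivative)
  qed simp
  moreover have "(fact j * fact 0 / fact (j + 0 + 1) :: real) = 1 / real (Suc j)"
    by (simp add: fact_Suc del: of_nat_Suc)
  ultimately show ?case by simp
next
  case (Suc p)
  let ?c = "real (Suc p) / real (Suc j)"
  let ?P = "\<lambda>s::real. s ^ Suc j * (1 - s) ^ Suc p / real (Suc j)"
  have "((\<lambda>s. s ^ j * (1 - s) ^ Suc p - ?c * (s ^ Suc j * (1 - s) ^ p)) has_integral (?P 1 - ?P 0)) {0..1}"
  proof (rule fundamental_theorem_of_calculus)
    fix s :: real
    have "(?P has_real_derivative s ^ j * (1 - s) ^ Suc p - ?c * (s ^ Suc j * (1 - s) ^ p)) (at s within {0..1})"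
      by (rule derivative_eq_intros refl | simp)+ (simp add: field_simps)
    then show "(?P has_vector_derivative s ^ j * (1 - s) ^ Suc p - ?c * (s ^ Suc j * (1 - s) ^ p))
        (at s within {0..1})" by (simp add: has_real_derivative_iff_has_vector_derivative)
  qed simp
  from has_integral_add[OF this has_integral_mult_right[OF Suc.IH[of "Suc j"], of ?c]]
  have "((\<lambda>s. s ^ j * (1 - s) ^ Suc p) has_integral ?c * (fact (Suc j) * fact p / fact (Suc j + p + 1))) {0..1::real}"
    by simp
  moreover have "?c * (fact (Suc j) * fact p / fact (Suc j + p + 1)) = fact j * fact (Suc p) / fact (j + Suc p + 1)"
    by (simp add: fact_Suc[of j] fact_Suc[of p])
  ultimately show ?case by (simp only:)
qed

lemma Taylor_weight_integral:
  assumes "1 \<le> N"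
  shows "real N * integral {0..1} (\<lambda>s. s ^ j * (1 - s) ^ (N - 1)) = 1 / real ((N + j) choose N)"
proof -
  have "integral {0..1} (\<lambda>s::real. s ^ j * (1 - s) ^ (N - 1)) = fact j * fact (N - 1) / fact (j + (N - 1) + 1)"
    by (rule integral_unique[OF has_integral_Beta_nat])
  moreover have "real N * fact (N - 1) = fact N" using assms by (metis Suc_diff_1 fact_Suc less_eq_Suc_le One_nat_def)
  moreover have "real ((N + j) choose N) = fact (N + j) / (fact N * fact j)"
    by (subst binomial_fact) simp_all
  moreover have "j + (N - 1) + 1 = N + j" using assms by simp
  ultimately have "real N * integral {0..1} (\<lambda>s. s ^ j * (1 - s) ^ (N - 1)) = fact N * fact j / fact (N + j)"
    by (simp add: mult.left_commute mult.commute add.commute)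
  then show ?thesis using \<open>real ((N + j) choose N) = _\<close> by simp
qed

lemma finite_mabs_le: "finite {k :: nat ^ 'M::finite. mabs k \<le> N}"
proof (rule finite_subset)
  show "{k :: nat ^ 'M. mabs k \<le> N} \<subseteq> (\<lambda>f. \<chi> i. f i) ` (PiE UNIV (\<lambda>_. {..N}))"
  proof
    fix k :: "nat ^ 'M" assume "k \<in> {k. mabs k \<le> N}"
    moreover have "k $ i \<le> mabs k" for i unfolding mabs_def by (rule member_le_sum) auto
    ultimately have "k $ i \<le> N" for i using le_trans by blast
    then show "k \<in> (\<lambda>f. \<chi> i. f i) ` (PiE UNIV (\<lambda>_. {..N}))"
      by (intro image_eqI[where x = "($) k"]) auto
  qed
qed (intro finite_imageI finite_PiE; simp)

lemma mabs_mono: "l \<le> m \<Longrightarrow> mabs l \<le> mabs m"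
  unfolding mabs_def less_eq_vec_def by (rule sum_mono) auto

lemma finite_multi_le: "finite {l :: nat ^ 'M::finite. l \<le> m}"
  by (rule finite_subset[OF _ finite_mabs_le[of "mabs m"]]) (auto intro: mabs_mono)

text \<open>Both sides are the coefficient of degree \<open>N\<close> in \<open>(1 + x) ^ mabs m\<close>, the left one after
  expanding each factor of the product of the powers \<open>(1 + x) ^ (m $ i)\<close>.\<close>

lemma multi_vandermonde:
  fixes m :: "nat ^ 'M::finite"
  shows "(\<Sum>l\<in>{l. mabs l = N \<and> l \<le> m}. mbinom m l) = real (mabs m choose N)"
proof -
  have expand: "[:1, 1:] ^ n = (\<Sum>j\<le>n. monom (real (n choose j)) j)" for n
  proof (rule poly_eqI)
    fix i
    have "coeff ([:1, 1:] ^ n) i = real (n choose i)"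
    proof (cases "i \<le> n")
      case True
      then show ?thesis by (simp add: coeff_linear_poly_power)
    next
      case False
      then show ?thesis by (simp add: coeff_eq_0 degree_linear_power)
    qed
    then show "coeff ([:1, 1:] ^ n) i = coeff (\<Sum>j\<le>n. monom (real (n choose j)) j) i"
      by (simp add: coeff_sum)
  qed
  have mon: "(\<Prod>i\<in>UNIV. monom (c i) (l $ i)) = monom (\<Prod>i\<in>UNIV. c i) (mabs l)"
    for c :: "'M \<Rightarrow> real" and l :: "nat ^ 'M"
  proof -
    have "(\<Prod>i\<in>I. monom (c i) (l $ i)) = monom (\<Prod>i\<in>I. c i) (\<Sum>i\<in>I. l $ i)" if "finite I" for I
      using that by (induction I) (auto simp: mult_monom)
    then show ?thesis by (simp add: mabs_def)
  qed
  have "[:1, 1:] ^ mabs m = (\<Prod>i\<in>UNIV. [:1, 1::real:] ^ (m $ i))" by (simp add: mabs_def power_sum)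
  also have "\<dots> = (\<Prod>i\<in>UNIV. \<Sum>j\<le>m $ i. monom (real (m $ i choose j)) j)" by (simp only: expand)
  also have "\<dots> = (\<Sum>f\<in>PiE UNIV (\<lambda>i. {..m $ i}). \<Prod>i\<in>UNIV. monom (real (m $ i choose f i)) (f i))"
    by (rule prod_sum_PiE) auto
  also have "\<dots> = (\<Sum>l\<in>{l. l \<le> m}. monom (mbinom m l) (mabs l))"
    by (rule sum.reindex_bij_witness[where i = "\<lambda>l. ($) l" and j = "\<lambda>f. \<chi> i. f i"])
      (auto simp: less_eq_vec_def mbinom_def mon[symmetric] PiE_def)
  finally have "coeff ([:1, 1::real:] ^ mabs m) N = coeff (\<Sum>l\<in>{l. l \<le> m}. monom (mbinom m l) (mabs l)) N"
    by (simp only:)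
  also have "\<dots> = (\<Sum>l\<in>{l. l \<le> m}. if mabs l = N then mbinom m l else 0)"
    by (simp add: coeff_sum)
  also have "\<dots> = (\<Sum>l\<in>{l. mabs l = N \<and> l \<le> m}. mbinom m l)"
    by (rule sum.mono_neutral_cong_right) (auto simp: finite_multi_le)
  finally show ?thesis by (cases "N \<le> mabs m") (simp_all add: expand coeff_sum binomial_eq_0)
qed

lemma multi_add_diff: "l \<le> m \<Longrightarrow> m - l + l = (m :: nat ^ 'M::finite)"
  by (simp add: vec_eq_iff less_eq_vec_def)

text \<open>At the centre \<open>X\<close> the averaged function is the constant \<open>mderiv m f X\<close>, so only the integral of
  the weight remains: \<open>mabs m - N\<close> differentiations have turned it into
  \<open>N s\<^sup>j (1 - s)\<^sup>p\<close> with \<open>j = mabs m - N\<close> and \<open>p = N - 1\<close>, a Beta integral.\<close>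

lemma mderiv_taylor_coeff:
  fixes f :: "real ^ 'M::finite \<Rightarrow> 'u::{real_inner, banach}"
  assumes "open S" "X \<in> S" "Ck_on (mabs m) S f" "1 \<le> N" "mabs l = N" "l \<le> m"
  shows "mderiv (m - l) (taylor_coeff N f l X) X = (1 / real (mabs m choose N)) *\<^sub>R mderiv m f X"
proof -
  obtain e where e: "0 < e" "ball X e \<subseteq> S" using assms(1,2) open_contains_ball by blast
  let ?w = "\<lambda>s::real. real N * (1 - s) ^ (N - 1)"
  let ?bs = "mdirs (m - l)"
  have m: "mabs (m - l) + mabs l = mabs m" using mabs_add[of "m - l" l] multi_add_diff[OF assms(6)] by simp
  have "Ck_on (mabs (m - l)) S (mderiv l f)"
    using assms(3) m by (intro Ck_on_mderiv) (simp add: add.commute)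
  then have C: "Ck_on (length ?bs) (ball X e) (mderiv l f)"
    unfolding mdirs(1) using e(2) by (rule Ck_on_subset)
  have "taylor_coeff N f l X = segment_average ?w (mderiv l f) X"
    by (simp add: taylor_coeff_def segment_average_def fun_eq_iff flip: integral_cmul)
  then have "mderiv (m - l) (taylor_coeff N f l X) X
      = segment_average (\<lambda>s. s ^ mabs (m - l) * ?w s) (mderiv (m - l) (mderiv l f)) X X"
    using foldr_dir_deriv_segment_average[OF C _ mdirs(2), of ?w X] e(1)
    by (simp add: mderiv_eq_foldr mdirs(1) continuous_intros)
  also have "\<dots> = segment_average (\<lambda>s. s ^ mabs (m - l) * ?w s) (\<lambda>x. mderiv m f X) X X"
    using mderiv_add[OF assms(1) _ assms(2), of "m - l" l f] assms(3) m multi_add_diff[OF assms(6)]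
    by (simp add: segment_average_def)
  also have "\<dots> = integral {0..1} (\<lambda>s. s ^ mabs (m - l) * ?w s) *\<^sub>R mderiv m f X"
    unfolding segment_average_def
    by (intro integral_unique has_integral_scaleR_left integrable_integral integrable_continuous_interval continuous_intros)
  also have "integral {0..1} (\<lambda>s. s ^ mabs (m - l) * ?w s)
      = real N * integral {0..1} (\<lambda>s. s ^ mabs (m - l) * (1 - s) ^ (N - 1))"
    by (subst integral_mult_right[symmetric]) (simp add: mult.left_commute)
  also have "\<dots> = 1 / real (mabs m choose N)"
    using Taylor_weight_integral[OF assms(4), of "mabs (m - l)"] m assms(5) by (simp add: add.commute)
  finally show ?thesis .
qed

text \<open>The coupling term is just the part of the differentiated equation with derivatives of order above
  \<open>N\<close>. Each such derivative is spread over all \<open>l\<close> of order \<open>N\<close> below \<open>k + n\<close>, with weights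
  \<open>mbinom (k + n) l / (mabs (k + n) choose N)\<close> that sum to one by the Vandermonde identity.\<close>

lemma coupling_coeff_eq:
  fixes f :: "real ^ 'M::finite \<Rightarrow> 'u::{real_inner, banach}"
  assumes "open S" "X \<in> S" "1 \<le> N" "finite (op_support D L)"
    and lin: "\<And>k. linear_op (D k) (L k)"
    and n: "mabs n \<le> N"
    and C: "\<And>k. k \<in> op_support D L \<Longrightarrow> Ck_on (mabs (k + n)) S f"
    and dom: "\<And>k. k \<in> op_support D L \<Longrightarrow> mderiv (k + n) f X \<in> D k"
  shows "coupling_coeff D L N f X n
    = (\<Sum>k\<in>{k \<in> op_support D L. N < mabs (k + n)}. L k (mderiv (k + n) f X))"
proof -
  have inner: "(\<Sum>l\<in>{l. mabs l = N \<and> l < n + k}.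
      L k (mbinom (k + n) l *\<^sub>R mderiv (k + n - l) (taylor_coeff N f l X) X))
      = (if N < mabs (k + n) then L k (mderiv (k + n) f X) else 0)"
    if k: "k \<in> op_support D L" for k
  proof (cases "N < mabs (k + n)")
    case True
    let ?I = "{l. mabs l = N \<and> l \<le> k + n}"
    have I: "{l. mabs l = N \<and> l < n + k} = ?I"
      using True by (auto simp: less_le add.commute)
    have c: "real (mabs (k + n) choose N) \<noteq> 0" using True by (simp add: binomial_eq_0_iff)
    have "(\<Sum>l\<in>?I. L k (mbinom (k + n) l *\<^sub>R mderiv (k + n - l) (taylor_coeff N f l X) X))
        = (\<Sum>l\<in>?I. (mbinom (k + n) l / real (mabs (k + n) choose N)) *\<^sub>R L k (mderiv (k + n) f X))"
      using linear_op_scaleR(2)[OF lin dom[OF k]]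
      by (intro sum.cong) (simp_all add: mderiv_taylor_coeff[OF assms(1,2) C[OF k] assms(3)])
    also have "\<dots> = L k (mderiv (k + n) f X)"
      using c by (simp add: scaleR_sum_left[symmetric] sum_divide_distrib[symmetric] multi_vandermonde)
    finally show ?thesis using True I by simp
  next
    case False
    have "mabs l < mabs (n + k)" if "l < n + k" for l
    proof -
      have "l \<le> n + k" "l \<noteq> n + k" using that by auto
      have "mabs (n + k - l) \<noteq> 0"
      proof
        assume "mabs (n + k - l) = 0"
        then have "n + k - l = 0" by (simp add: mabs_def vec_eq_iff)
        then show False using multi_add_diff[OF \<open>l \<le> n + k\<close>] \<open>l \<noteq> n + k\<close> by simp
      qed
      then show ?thesis using mabs_add[of "n + k - l" l] multi_add_diff[OF \<open>l \<le> n + k\<close>] by simp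
    qed
    then have empty: "{l. mabs l = N \<and> l < n + k} = {}" using False by (force simp: add.commute)
    show ?thesis unfolding empty using False by simp
  qed
  have "coupling_coeff D L N f X n = (\<Sum>k\<in>{k \<in> op_support D L. 1 \<le> mabs k}.
      if N < mabs (k + n) then L k (mderiv (k + n) f X) else 0)"
    unfolding coupling_coeff_def by (intro sum.cong inner refl) auto
  also have "\<dots> = (\<Sum>k\<in>{k \<in> op_support D L. N < mabs (k + n)}. L k (mderiv (k + n) f X))"
  proof (rule sum.mono_neutral_cong)
    show "finite {k \<in> op_support D L. 1 \<le> mabs k}" "finite {k \<in> op_support D L. N < mabs (k + n)}"
      using assms(4) by auto
  qed (use n in \<open>auto simp: mabs_add\<close>)
  finally show ?thesis .
qed

section \<open>Bounded semigroups and variation of constants\<close>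

text \<open>Lets two-sided difference quotients along an orbit be expressed by the one-sided limit at \<open>0\<close>
  that defines the generator.\<close>

lemma filterlim_abs_diff_at_right: "filterlim (\<lambda>s. \<bar>s - r\<bar>) (at_right (0::real)) (at r within S)"
  unfolding filterlim_at
proof
  have "((\<lambda>s. \<bar>s - r\<bar>) \<longlongrightarrow> \<bar>r - r\<bar>) (at r within S)" by (intro tendsto_intros)
  then show "((\<lambda>s. \<bar>s - r\<bar>) \<longlongrightarrow> 0) (at r within S)" by simp
qed (simp add: eventually_at_filter)

text \<open>The semigroup on the stable coordinates is uniformly bounded, as its growth is governed by
  eigenvalues with negative real part. A uniform bound makes limits pass through \<open>T t\<close> uniformly in \<open>t\<close>.\<close>

context
  fixes DB :: "'s::banach set" and B :: "'s \<Rightarrow> 's" and T :: "real \<Rightarrow> 's \<Rightarrow> 's" and C :: real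
  assumes gen: "generates_on UNIV DB B T"
    and bounded: "\<And>t x. 0 \<le> t \<Longrightarrow> norm (T t x) \<le> C * norm x"
begin

lemma semigroup_add: "0 \<le> s \<Longrightarrow> 0 \<le> t \<Longrightarrow> T (s + t) x = T s (T t x)"
  using gen by (simp add: generates_on_def c0_semigroup_on_def)

lemma semigroup_linear_op: "0 \<le> t \<Longrightarrow> linear_op UNIV (T t)"
  using gen by (simp add: generates_on_def c0_semigroup_on_def)

lemma semigroup_diff: "0 \<le> t \<Longrightarrow> T t (x - y) = T t x - T t y"
  by (rule linear_op_diff(2)[OF semigroup_linear_op]) auto

lemma semigroup_scaleR: "0 \<le> t \<Longrightarrow> T t (c *\<^sub>R x) = c *\<^sub>R T t x"
  by (rule linear_op_scaleR(2)[OF semigroup_linear_op]) auto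

lemma semigroup_zero: "T 0 x = x"
  using gen by (simp add: generates_on_def c0_semigroup_on_def)

lemma generator_iff:
  "((\<lambda>h. (T h x - x) /\<^sub>R h) \<longlongrightarrow> y) (at_right 0) \<longleftrightarrow> x \<in> DB \<and> y = B x"
  using gen by (simp add: generates_on_def)

lemma generator_diff:
  assumes "x \<in> DB" "y \<in> DB"
  shows "x - y \<in> DB" "B (x - y) = B x - B y"
proof -
  have "((\<lambda>h. (T h x - x) /\<^sub>R h - (T h y - y) /\<^sub>R h) \<longlongrightarrow> B x - B y) (at_right 0)"
    using assms generator_iff by (intro tendsto_diff) auto
  moreover have "\<forall>\<^sub>F h in at_right 0. (T h x - x) /\<^sub>R h - (T h y - y) /\<^sub>R h = (T h (x - y) - (x - y)) /\<^sub>R h"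
    using eventually_at_right_less[of "0::real"]
    by eventually_elim (simp add: semigroup_diff scaleR_diff_right)
  ultimately have "((\<lambda>h. (T h (x - y) - (x - y)) /\<^sub>R h) \<longlongrightarrow> B x - B y) (at_right 0)"
    by (rule Lim_transform_eventually)
  then show "x - y \<in> DB" "B (x - y) = B x - B y" using generator_iff by auto
qed

text \<open>Factoring out the semigroup at the earlier of the two times treats increments to the right and to
  the left alike.\<close>

lemma semigroup_orbit_diff:
  assumes "0 \<le> a" "0 \<le> b"
  shows "T a x - T b x = sgn (a - b) *\<^sub>R T (min a b) (T \<bar>a - b\<bar> x - x)"
proof -
  consider "b < a" | "a = b" | "a < b" by linarith
  then show ?thesis
  proof cases
    case 1
    then show ?thesis using assms semigroup_add[of b "a - b" x] by (simp add: semigroup_diff min_def)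
  next
    case 3
    then show ?thesis using assms semigroup_add[of a "b - a" x] by (simp add: semigroup_diff min_def)
  qed simp
qed

lemma semigroup_orbit_continuous: "continuous_on {0..} (\<lambda>r. T r x)"
  unfolding continuous_on_def
proof
  fix r :: real assume r: "r \<in> {0..}"
  have "((\<lambda>h. T h x) \<longlongrightarrow> x) (at_right 0)" using gen by (simp add: generates_on_def c0_semigroup_on_def)
  from filterlim_compose[OF this filterlim_abs_diff_at_right]
  have "((\<lambda>s. T \<bar>s - r\<bar> x) \<longlongrightarrow> x) (at r within {0..})" .
  then have "((\<lambda>s. C * norm (T \<bar>s - r\<bar> x - x)) \<longlongrightarrow> C * norm (x - x)) (at r within {0..})"
    by (intro tendsto_intros)
  then have lim: "((\<lambda>s. C * norm (T \<bar>s - r\<bar> x - x)) \<longlongrightarrow> 0) (at r within {0..})" by simp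
  have bd: "norm (T s x - T r x) \<le> C * norm (T \<bar>s - r\<bar> x - x)" if "s \<in> {0..}" for s
  proof -
    have "norm (T s x - T r x) \<le> norm (T (min s r) (T \<bar>s - r\<bar> x - x))"
      using that r semigroup_orbit_diff[of s r x] by (simp add: abs_sgn_eq)
    also have "\<dots> \<le> C * norm (T \<bar>s - r\<bar> x - x)" using that r by (intro bounded) simp
    finally show ?thesis .
  qed
  have "((\<lambda>s. T s x - T r x) \<longlongrightarrow> 0) (at r within {0..})"
    by (rule Lim_null_comparison[OF _ lim]) (auto simp: eventually_at_filter intro!: always_eventually bd)
  then show "((\<lambda>s. T s x) \<longlongrightarrow> T r x) (at r within {0..})" by (simp add: LIM_zero_iff)
qed

lemma semigroup_generator_commute:
  assumes "x \<in> DB" "0 \<le> t"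
  shows "T t x \<in> DB" "B (T t x) = T t (B x)"
proof -
  have lim: "((\<lambda>h. (T h x - x) /\<^sub>R h) \<longlongrightarrow> B x) (at_right 0)" using assms(1) generator_iff by blast
  have "bounded_linear (T t)"
    using semigroup_linear_op[OF assms(2)] bounded[OF assms(2)]
    by (intro bounded_linear_intro[where K = C]) (auto simp: linear_op_def mult.commute)
  from bounded_linear.tendsto[OF this lim]
  have "((\<lambda>h. T t ((T h x - x) /\<^sub>R h)) \<longlongrightarrow> T t (B x)) (at_right 0)" .
  moreover have "\<forall>\<^sub>F h in at_right 0. T t ((T h x - x) /\<^sub>R h) = (T h (T t x) - T t x) /\<^sub>R h"
    using eventually_at_right_less[of "0::real"]
  proof eventually_elim
    case (elim h)
    have "T t (T h x) = T h (T t x)"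
      using semigroup_add[of t h x] semigroup_add[of h t x] assms(2) elim by (simp add: add.commute)
    then show ?case using assms(2) by (simp add: semigroup_scaleR semigroup_diff)
  qed
  ultimately have "((\<lambda>h. (T h (T t x) - T t x) /\<^sub>R h) \<longlongrightarrow> T t (B x)) (at_right 0)"
    by (rule Lim_transform_eventually)
  then show "T t x \<in> DB" "B (T t x) = T t (B x)" using generator_iff by auto
qed

lemma semigroup_tendsto:
  assumes "(f \<longlongrightarrow> y) F" "(g \<longlongrightarrow> r) F" "\<forall>\<^sub>F s in F. g s \<in> {0..}" "0 \<le> r"
  shows "((\<lambda>s. T (g s) (f s)) \<longlongrightarrow> T r y) F"
proof -
  have "((\<lambda>s. T (g s) y) \<longlongrightarrow> T r y) F"
    using continuous_on_tendsto_compose[OF semigroup_orbit_continuous assms(2) _ assms(3)] assms(4) by simp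
  moreover have "((\<lambda>s. T (g s) (f s - y)) \<longlongrightarrow> 0) F"
  proof (rule Lim_null_comparison)
    show "\<forall>\<^sub>F s in F. norm (T (g s) (f s - y)) \<le> C * norm (f s - y)"
      using assms(3) by eventually_elim (simp add: bounded)
    have "((\<lambda>s. C * norm (f s - y)) \<longlongrightarrow> C * norm (y - y)) F" by (intro tendsto_intros assms(1))
    then show "((\<lambda>s. C * norm (f s - y)) \<longlongrightarrow> 0) F" by simp
  qed
  ultimately have "((\<lambda>s. T (g s) (f s - y) + T (g s) y) \<longlongrightarrow> 0 + T r y) F" by (intro tendsto_add)
  moreover have "\<forall>\<^sub>F s in F. T (g s) (f s - y) + T (g s) y = T (g s) (f s)"
    using assms(3) by eventually_elim (simp add: semigroup_diff)
  ultimately show ?thesis using Lim_transform_eventually by fastforce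
qed

lemma semigroup_orbit_derivative:
  assumes "x \<in> DB" "0 \<le> r"
  shows "((\<lambda>s. T s x) has_vector_derivative T r (B x)) (at r within {0..})"
  unfolding has_vector_derivative_within_quotient
proof (rule Lim_transform_eventually)
  have "((\<lambda>h. (T h x - x) /\<^sub>R h) \<longlongrightarrow> B x) (at_right 0)" using assms(1) generator_iff by blast
  from filterlim_compose[OF this filterlim_abs_diff_at_right]
  have q: "((\<lambda>s. (T \<bar>s - r\<bar> x - x) /\<^sub>R \<bar>s - r\<bar>) \<longlongrightarrow> B x) (at r within {0..})" .
  have "((\<lambda>s. min s r) \<longlongrightarrow> min r r) (at r within {0..})" by (intro tendsto_intros)
  then have m: "((\<lambda>s. min s r) \<longlongrightarrow> r) (at r within {0..})" by simp
  show "((\<lambda>s. T (min s r) ((T \<bar>s - r\<bar> x - x) /\<^sub>R \<bar>s - r\<bar>)) \<longlongrightarrow> T r (B x)) (at r within {0..})"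
    by (rule semigroup_tendsto[OF q m _ assms(2)]) (use assms(2) in \<open>auto simp: eventually_at_filter\<close>)
  have "T (min s r) ((T \<bar>s - r\<bar> x - x) /\<^sub>R \<bar>s - r\<bar>) = (T s x - T r x) /\<^sub>R (s - r)" if "0 \<le> s" "s \<noteq> r" for s
  proof -
    have "inverse (s - r) * sgn (s - r) = inverse \<bar>s - r\<bar>" 
      using that(2) inverse_minus_eq[of "s - r"] by (simp add: sgn_if abs_if)
    then show ?thesis
      using that assms(2) by (simp add: semigroup_orbit_diff semigroup_scaleR)
  qed
  then show "\<forall>\<^sub>F s in at r within {0..}. T (min s r) ((T \<bar>s - r\<bar> x - x) /\<^sub>R \<bar>s - r\<bar>) = (T s x - T r x) /\<^sub>R (s - r)"
    by (auto simp: eventually_at_filter)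
qed

text \<open>The product rule for \<open>\<sigma> \<mapsto> T (t - \<sigma>) (y \<sigma>)\<close>: differentiating the semigroup produces \<open>- B (y \<tau>)\<close>,
  differentiating \<open>y\<close> produces \<open>y'\<close>.\<close>

lemma semigroup_product_derivative:
  assumes y: "(y has_vector_derivative y') (at \<tau> within {0..t})" and "y \<tau> \<in> DB" and \<tau>: "\<tau> \<in> {0..t}"
  shows "((\<lambda>\<sigma>. T (t - \<sigma>) (y \<sigma>)) has_vector_derivative T (t - \<tau>) (y' - B (y \<tau>))) (at \<tau> within {0..t})"
  unfolding has_vector_derivative_within_quotient
proof (rule Lim_transform_eventually)
  have dt: "((\<lambda>\<sigma>. t - \<sigma>) has_vector_derivative -1) (at \<tau> within {0..t})"
    by (auto intro!: derivative_eq_intros simp: has_real_derivative_iff_has_vector_derivative[symmetric])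
  have "((\<lambda>s. T s (y \<tau>)) has_vector_derivative T (t - \<tau>) (B (y \<tau>))) (at (t - \<tau>) within (\<lambda>\<sigma>. t - \<sigma>) ` {0..t})"
    using \<tau> by (intro has_vector_derivative_within_subset[OF semigroup_orbit_derivative[OF assms(2)]]) auto
  from vector_diff_chain_within[OF dt this]
  have "((\<lambda>\<sigma>. T (t - \<sigma>) (y \<tau>)) has_vector_derivative - T (t - \<tau>) (B (y \<tau>))) (at \<tau> within {0..t})"
    by (simp add: o_def)
  then have 1: "((\<lambda>\<sigma>. (T (t - \<sigma>) (y \<tau>) - T (t - \<tau>) (y \<tau>)) /\<^sub>R (\<sigma> - \<tau>)) \<longlongrightarrow> - T (t - \<tau>) (B (y \<tau>)))
      (at \<tau> within {0..t})"
    by (simp only: has_vector_derivative_within_quotient)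
  have 2: "((\<lambda>\<sigma>. T (t - \<sigma>) ((y \<sigma> - y \<tau>) /\<^sub>R (\<sigma> - \<tau>))) \<longlongrightarrow> T (t - \<tau>) y') (at \<tau> within {0..t})"
  proof (rule semigroup_tendsto)
    show "((\<lambda>\<sigma>. (y \<sigma> - y \<tau>) /\<^sub>R (\<sigma> - \<tau>)) \<longlongrightarrow> y') (at \<tau> within {0..t})"
      using y by (simp only: has_vector_derivative_within_quotient)
    show "((\<lambda>\<sigma>. t - \<sigma>) \<longlongrightarrow> t - \<tau>) (at \<tau> within {0..t})" by (intro tendsto_intros)
  qed (use \<tau> in \<open>auto simp: eventually_at_filter\<close>)
  show "((\<lambda>\<sigma>. T (t - \<sigma>) ((y \<sigma> - y \<tau>) /\<^sub>R (\<sigma> - \<tau>)) + (T (t - \<sigma>) (y \<tau>) - T (t - \<tau>) (y \<tau>)) /\<^sub>R (\<sigma> - \<tau>))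
      \<longlongrightarrow> T (t - \<tau>) (y' - B (y \<tau>))) (at \<tau> within {0..t})"
    using tendsto_add[OF 2 1] \<tau> by (simp add: semigroup_diff)
  show "\<forall>\<^sub>F \<sigma> in at \<tau> within {0..t}.
      T (t - \<sigma>) ((y \<sigma> - y \<tau>) /\<^sub>R (\<sigma> - \<tau>)) + (T (t - \<sigma>) (y \<tau>) - T (t - \<tau>) (y \<tau>)) /\<^sub>R (\<sigma> - \<tau>)
      = (T (t - \<sigma>) (y \<sigma>) - T (t - \<tau>) (y \<tau>)) /\<^sub>R (\<sigma> - \<tau>)"
    by (auto simp: eventually_at_filter semigroup_diff semigroup_scaleR scaleR_add_right[symmetric]
        intro!: always_eventually)
qed

text \<open>Along a solution of \<open>y' = B y + f\<close> the product rule leaves only \<open>T (t - \<tau>) (f \<tau>)\<close>, so the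
  fundamental theorem of calculus for the gauge integral gives the integrability of the convolution
  together with its value.\<close>

lemma variation_of_constants:
  assumes "0 \<le> t" "\<And>\<tau>. y \<tau> \<in> DB" "\<And>\<tau>. (y has_vector_derivative B (y \<tau>) + f \<tau>) (at \<tau>)"
  shows "((\<lambda>\<tau>. T (t - \<tau>) (f \<tau>)) has_integral (y t - T t (y 0))) {0..t}"
proof -
  have "((\<lambda>\<tau>. T (t - \<tau>) (y \<tau>)) has_vector_derivative T (t - \<tau>) (f \<tau>)) (at \<tau> within {0..t})"
    if "\<tau> \<in> {0..t}" for \<tau>
    using semigroup_product_derivative[OF has_vector_derivative_at_within[OF assms(3)] assms(2) that] by simp
  from fundamental_theorem_of_calculus[OF assms(1) this]
  show ?thesis by (simp add: semigroup_zero)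
qed

end

section \<open>The generating multinomial operator and its coordinates\<close>

lemma fun_sum_apply: "(\<Sum>i\<in>I. f i) x = (\<Sum>i\<in>I. f i x)"
  by (induction I rule: infinite_finite_induct) auto

lemma fun_scaleR_apply: "(c *\<^sub>R f) x = c *\<^sub>R f x"
  by (simp add: scaleR_fun_def)

text \<open>The product of a row of field values and a column of coordinates.\<close>

definition row_vec :: "'u::real_vector ^ 'm::finite \<Rightarrow> real ^ 'm \<Rightarrow> 'u"
  where "row_vec V a = (\<Sum>j\<in>UNIV. (a $ j) *\<^sub>R (V $ j))"

lemma row_vec_row_mat: "row_vec (row_mat V A) a = row_vec V (A *v a)"
proof -
  have "row_vec (row_mat V A) a = (\<Sum>j\<in>UNIV. \<Sum>i\<in>UNIV. (A $ i $ j * a $ j) *\<^sub>R (V $ i))"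
    by (simp add: row_vec_def row_mat_def scaleR_sum_right mult.commute)
  also have "\<dots> = (\<Sum>i\<in>UNIV. \<Sum>j\<in>UNIV. (A $ i $ j * a $ j) *\<^sub>R (V $ i))" by (rule sum.swap)
  also have "\<dots> = row_vec V (A *v a)"
    by (simp add: row_vec_def matrix_vector_mult_def scaleR_sum_left)
  finally show ?thesis .
qed

lemma row_vec_sum_left: "row_vec (\<Sum>k\<in>K. V k) a = (\<Sum>k\<in>K. row_vec (V k) a)"
  unfolding row_vec_def by (subst sum.swap) (simp add: scaleR_sum_right)

lemma row_vec_sum_right: "row_vec V (\<Sum>k\<in>K. a k) = (\<Sum>k\<in>K. row_vec V (a k))"
  unfolding row_vec_def by (subst sum.swap) (simp add: scaleR_sum_left)

lemma linear_op_row_vec: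
  assumes "linear_op D L" "\<And>j. V $ j \<in> D"
  shows "row_vec V a \<in> D" "L (row_vec V a) = row_vec (row_apply L V) a"
proof -
  have "(\<Sum>j\<in>UNIV. (a $ j) *\<^sub>R (V $ j)) \<in> D \<and>
      L (\<Sum>j\<in>UNIV. (a $ j) *\<^sub>R (V $ j)) = (\<Sum>j\<in>UNIV. L ((a $ j) *\<^sub>R (V $ j)))"
    by (rule linear_op_sum[OF assms(1)]) (simp add: linear_op_scaleR(1)[OF assms])
  then show "row_vec V a \<in> D" "L (row_vec V a) = row_vec (row_apply L V) a"
    by (simp_all add: row_vec_def row_apply_def linear_op_scaleR(2)[OF assms])
qed

lemma pair_row_vec: "pair Z (row_vec V a) = gram Z V *v a"
  by (simp add: pair_def row_vec_def gram_def matrix_vector_mult_def inner_sum_right vec_eq_iff mult.commute)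

lemma bounded_linear_pair: "bounded_linear (pair Z)"
proof (rule bounded_linear_intro[where K = "\<Sum>i\<in>UNIV. norm (Z $ i)"])
  fix v
  have "norm (pair Z v) \<le> (\<Sum>i\<in>UNIV. \<bar>pair Z v $ i\<bar>)" by (rule norm_le_l1_cart)
  also have "\<dots> \<le> (\<Sum>i\<in>UNIV. norm (Z $ i) * norm v)"
    by (intro sum_mono) (simp add: pair_def Cauchy_Schwarz_ineq2)
  finally show "norm (pair Z v) \<le> norm v * (\<Sum>i\<in>UNIV. norm (Z $ i))"
    by (simp add: sum_distrib_left mult.commute)
qed (simp_all add: pair_def vec_eq_iff inner_add_right)

lemma gen_comb_apply:
  "gen_comb V N a n = (1 / mfact n) *\<^sub>R (\<Sum>p\<in>{p. mabs p \<le> N \<and> n \<le> p}. row_vec (V (p - n)) (a p))"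
proof -
  have "gen_comb V N a n = (\<Sum>p\<in>{p. mabs p \<le> N}.
      if n \<le> p then (1 / mfact n) *\<^sub>R row_vec (V (p - n)) (a p) else 0)"
    unfolding gen_comb_def fun_sum_apply fun_scaleR_apply gen_column_def row_vec_def
    by (intro sum.cong refl) (simp add: scaleR_sum_right mult.commute)
  also have "\<dots> = (\<Sum>p\<in>{p. mabs p \<le> N \<and> n \<le> p}. (1 / mfact n) *\<^sub>R row_vec (V (p - n)) (a p))"
    by (rule sum.mono_neutral_cong_right) (auto simp: finite_mabs_le)
  finally show ?thesis by (simp add: scaleR_sum_right)
qed

lemma mfact_pos: "0 < mfact n"
  by (simp add: mfact_def prod_pos)

lemma mfact_nonzero: "mfact n \<noteq> 0"
  using mfact_pos[of n] by simp

lemma xi_deriv_gen_comb: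
  "xi_deriv k (gen_comb V N a) n =
    (1 / mfact n) *\<^sub>R (\<Sum>p\<in>{p. mabs p \<le> N \<and> n + k \<le> p}. row_vec (V (p - (n + k))) (a p))"
  using mfact_nonzero[of "n + k"] by (simp add: xi_deriv_def gen_comb_apply)

lemma gen_comb_multinomial:
  fixes V :: "nat ^ 'M::finite \<Rightarrow> 'u::real_vector ^ 'm::finite"
  shows "gen_comb V N a \<in> multinomials N"
proof -
  have empty: "{p. mabs p \<le> N \<and> n \<le> p} = {}" if "N < mabs n" for n :: "nat ^ 'M"
    using that by (auto dest!: mabs_mono)
  show ?thesis by (simp add: multinomials_def gen_comb_apply empty)
qed

lemma gen_comb_in_gen_dom:
  assumes "\<And>k. linear_op (D k) (L k)" "\<And>n k j. mabs n + mabs k \<le> N \<Longrightarrow> V n $ j \<in> D k"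
  shows "gen_comb V N a \<in> gen_dom D N"
proof -
  have "xi_deriv k (gen_comb V N a) n \<in> D k" for k n
    unfolding xi_deriv_gen_comb
  proof (intro linear_op_scaleR(1)[OF assms(1)] conjunct1[OF linear_op_sum[OF assms(1)]] linear_op_row_vec(1)[OF assms(1)])
    fix p j assume "p \<in> {p. mabs p \<le> N \<and> n + k \<le> p}"
    then have "mabs (p - (n + k)) + mabs (n + k) \<le> N" by (simp flip: mabs_add add: multi_add_diff)
    then show "V (p - (n + k)) $ j \<in> D k" by (intro assms(2)) (simp add: mabs_add)
  qed
  then show ?thesis by (simp add: gen_dom_def gen_comb_multinomial)
qed

lemma xi_deriv_zero: "xi_deriv k 0 n = 0"
  by (simp add: xi_deriv_def)

lemma xi_deriv_add: "xi_deriv k (c + d) n = xi_deriv k c n + xi_deriv k d n"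
  by (simp add: xi_deriv_def scaleR_add_right)

lemma xi_deriv_scaleR: "xi_deriv k (r *\<^sub>R c) n = r *\<^sub>R xi_deriv k c n"
  by (simp add: xi_deriv_def fun_scaleR_apply mult.commute)

lemma linear_op_gen_op:
  assumes "\<And>k. linear_op (D k) (L k)"
  shows "linear_op (gen_dom D N) (gen_op L N)"
  unfolding linear_op_def
proof (intro conjI ballI allI)
  have sub: "subspace (D k)" for k using assms by (simp add: linear_op_def)
  have add: "L k (x + y) = L k x + L k y" if "x \<in> D k" "y \<in> D k" for k x y
    using assms[of k] that by (simp add: linear_op_def)
  show "subspace (gen_dom D N)"
    unfolding subspace_def gen_dom_def multinomials_def
    by (auto simp: xi_deriv_zero xi_deriv_add xi_deriv_scaleR fun_scaleR_apply subspace_add[OF sub]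
        subspace_scale[OF sub] subspace_0[OF sub])
  show "gen_op L N (x + y) = gen_op L N x + gen_op L N y" if "x \<in> gen_dom D N" "y \<in> gen_dom D N" for x y
  proof
    fix n
    have "gen_op L N (x + y) n = (\<Sum>k\<in>{k. mabs k \<le> N}. L k (xi_deriv k x n) + L k (xi_deriv k y n))"
      unfolding gen_op_def using that by (intro sum.cong refl) (simp add: xi_deriv_add add gen_dom_def)
    then show "gen_op L N (x + y) n = (gen_op L N x + gen_op L N y) n"
      by (simp add: gen_op_def sum.distrib)
  qed
  show "gen_op L N (r *\<^sub>R x) = r *\<^sub>R gen_op L N x" if "x \<in> gen_dom D N" for r x
  proof
    fix n
    have "gen_op L N (r *\<^sub>R x) n = (\<Sum>k\<in>{k. mabs k \<le> N}. r *\<^sub>R L k (xi_deriv k x n))"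
      unfolding gen_op_def using that
      by (intro sum.cong refl) (simp add: xi_deriv_scaleR linear_op_scaleR(2)[OF assms] gen_dom_def)
    then show "gen_op L N (r *\<^sub>R x) n = (r *\<^sub>R gen_op L N x) n"
      by (simp add: gen_op_def fun_scaleR_apply scaleR_sum_right)
  qed
qed

lemma mabs_eq_0: "mabs k = 0 \<longleftrightarrow> k = 0"
  by (simp add: mabs_def vec_eq_iff)

text \<open>The recursion with all its terms on the natural sides: the terms \<open>k = 0\<close> rejoin the sums, and the
  case \<open>q = 0\<close> is the defining equation of \<open>A 0\<close>.\<close>

lemma recursion_identity:
  fixes V :: "nat ^ 'M::finite \<Rightarrow> 'u::{real_inner, banach} ^ 'm::finite"
  assumes rec: "recursion D L N Z A V" and V0: "row_apply (L 0) (V 0) = row_mat (V 0) (A 0)" and q: "mabs q \<le> N"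
  shows "(\<Sum>k\<in>{k. k \<le> q}. row_apply (L k) (V (q - k))) = (\<Sum>k\<in>{k. k \<le> q}. row_mat (V (q - k)) (A k))"
proof -
  have split: "(\<Sum>k\<in>{k. k \<le> q}. g k) = g 0 + (\<Sum>k\<in>{k. 0 < mabs k \<and> k \<le> q}. g k)" for g :: "nat ^ 'M \<Rightarrow> 'u ^ 'm"
  proof -
    have "{k. k \<le> q} = insert 0 {k. 0 < mabs k \<and> k \<le> q}"
      by (auto simp: mabs_eq_0 less_eq_vec_def zero_less_iff_neq_zero)
    moreover have "finite {k. 0 < mabs k \<and> k \<le> q}"
      by (rule finite_subset[OF _ finite_multi_le[of q]]) auto
    ultimately show ?thesis by (simp add: mabs_def)
  qed
  show ?thesis
  proof (cases "q = 0")
    case True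
    have "{k. k \<le> (0 :: nat ^ 'M)} = {0}" by (auto simp: less_eq_vec_def vec_eq_iff)
    then show ?thesis using True V0 by simp
  next
    case False
    then have "0 < mabs q" by (simp add: mabs_eq_0 zero_less_iff_neq_zero)
    then have "row_apply (L 0) (V q) - row_mat (V q) (A 0) =
        - (\<Sum>k\<in>{k. 0 < mabs k \<and> k \<le> q}. row_apply (L k) (V (q - k)))
        + (\<Sum>k\<in>{k. 0 < mabs k \<and> k \<le> q}. row_mat (V (q - k)) (A k))"
      using rec q by (simp add: recursion_def)
    then show ?thesis unfolding split by (simp add: algebra_simps)
  qed
qed

text \<open>The action of \<open>gen_op\<close> on the coordinates of the centre columns: the column of index \<open>p\<close> is sent
  to the sum of the columns of index \<open>p - k\<close> times \<open>A k\<close>.\<close>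

definition centre_op :: "nat \<Rightarrow> (nat ^ 'M::finite \<Rightarrow> real ^ 'm::finite ^ 'm) \<Rightarrow>
    (nat ^ 'M \<Rightarrow> real ^ 'm) \<Rightarrow> nat ^ 'M \<Rightarrow> real ^ 'm"
  where "centre_op N A a = (\<lambda>q. \<Sum>k\<in>{k. mabs (q + k) \<le> N}. A k *v a (q + k))"

lemma centre_op_multinomial: "centre_op N A a \<in> multinomials N"
  by (auto simp: multinomials_def centre_op_def mabs_add intro!: sum.neutral)

text \<open>The centre columns span an invariant subspace. Collecting the terms that share the column
  \<open>p\<close>, the inner sum over \<open>k \<le> p - n\<close> is one instance of the recursion; the substitution
  \<open>q = p - k\<close> then reads off the new coordinates.\<close>

lemma gen_op_gen_comb:
  fixes V :: "nat ^ 'M::finite \<Rightarrow> 'u::{real_inner, banach} ^ 'm::finite"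
  assumes lin: "\<And>k. linear_op (D k) (L k)"
    and rec: "recursion D L N Z A V" and V0: "row_apply (L 0) (V 0) = row_mat (V 0) (A 0)"
  shows "gen_op L N (gen_comb V N a) = gen_comb V N (centre_op N A a)"
proof
  fix n :: "nat ^ 'M"
  have V_dom: "V p $ j \<in> D k" if "mabs p + mabs k \<le> N" for p k j using rec that by (simp add: recursion_def)
  let ?P = "{p. mabs p \<le> N \<and> n \<le> p}"
  let ?R = "\<lambda>k p. row_vec (row_apply (L k) (V (p - (n + k)))) (a p)"
  have fin: "finite {p. mabs p \<le> N \<and> Q p}" for Q
    by (rule finite_subset[OF _ finite_mabs_le[of N]]) auto
  have "L k (xi_deriv k (gen_comb V N a) n) = (1 / mfact n) *\<^sub>R (\<Sum>p\<in>{p. mabs p \<le> N \<and> n + k \<le> p}. ?R k p)" for k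
  proof -
    have dom: "V (p - (n + k)) $ j \<in> D k" if "mabs p \<le> N" "n + k \<le> p" for p j
    proof -
      have "mabs (p - (n + k)) + mabs (n + k) \<le> N" using that by (simp flip: mabs_add add: multi_add_diff)
      then show ?thesis by (intro V_dom) (simp add: mabs_add)
    qed
    have "(\<Sum>p\<in>{p. mabs p \<le> N \<and> n + k \<le> p}. row_vec (V (p - (n + k))) (a p)) \<in> D k \<and>
      L k (\<Sum>p\<in>{p. mabs p \<le> N \<and> n + k \<le> p}. row_vec (V (p - (n + k))) (a p)) =
      (\<Sum>p\<in>{p. mabs p \<le> N \<and> n + k \<le> p}. L k (row_vec (V (p - (n + k))) (a p)))"
      by (rule linear_op_sum[OF lin]) (auto intro!: linear_op_row_vec(1)[OF lin] dom)
    moreover have "(\<Sum>p\<in>{p. mabs p \<le> N \<and> n + k \<le> p}. L k (row_vec (V (p - (n + k))) (a p)))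
        = (\<Sum>p\<in>{p. mabs p \<le> N \<and> n + k \<le> p}. ?R k p)"
      by (intro sum.cong refl linear_op_row_vec(2)[OF lin]) (auto intro: dom)
    ultimately show ?thesis by (simp add: xi_deriv_gen_comb linear_op_scaleR(2)[OF lin])
  qed
  then have "gen_op L N (gen_comb V N a) n
      = (1 / mfact n) *\<^sub>R (\<Sum>k\<in>{k. mabs k \<le> N}. \<Sum>p\<in>{p. mabs p \<le> N \<and> n + k \<le> p}. ?R k p)"
    by (simp add: gen_op_def scaleR_sum_right)
  also have "(\<Sum>k\<in>{k. mabs k \<le> N}. \<Sum>p\<in>{p. mabs p \<le> N \<and> n + k \<le> p}. ?R k p)
      = (\<Sum>p\<in>?P. \<Sum>k\<in>{k. k \<le> p - n}. row_vec (row_apply (L k) (V (p - n - k))) (a p))"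
  proof -
    let ?G = "\<lambda>p. \<Sum>k\<in>{k. mabs k \<le> N \<and> n + k \<le> p}. ?R k p"
    have "(\<Sum>k\<in>{k. mabs k \<le> N}. \<Sum>p\<in>{p. mabs p \<le> N \<and> n + k \<le> p}. ?R k p) = (\<Sum>p\<in>{p. mabs p \<le> N}. ?G p)"
      using sum.swap_restrict[OF finite_mabs_le[of N] finite_mabs_le[of N], of ?R "\<lambda>k p. n + k \<le> p"] by simp
    also have "\<dots> = (\<Sum>p\<in>?P. \<Sum>k\<in>{k. k \<le> p - n}. row_vec (row_apply (L k) (V (p - n - k))) (a p))"
    proof (rule sum.mono_neutral_cong_right)
      have "n \<le> p" if "n + k \<le> p" for k p
        using that add_leD1 unfolding less_eq_vec_def vector_add_component by blast
      then have "{k. mabs k \<le> N \<and> n + k \<le> p} = {}" if "\<not> n \<le> p" for p using that by blast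
      then show "\<forall>p\<in>{p. mabs p \<le> N} - ?P. ?G p = 0" by fastforce
    next
      fix p assume p: "p \<in> ?P"
      have "n + k \<le> p \<longleftrightarrow> k \<le> p - n" for k
        using p by (auto simp: less_eq_vec_def le_diff_conv2 add.commute)
      moreover have "mabs k \<le> N" if "n + k \<le> p" for k
        using mabs_mono[OF that] p by (simp add: mabs_add)
      ultimately have "{k. mabs k \<le> N \<and> n + k \<le> p} = {k. k \<le> p - n}" by blast
      moreover have "p - (n + k) = p - n - k" for k by (simp add: vec_eq_iff)
      ultimately show "?G p = (\<Sum>k\<in>{k. k \<le> p - n}. row_vec (row_apply (L k) (V (p - n - k))) (a p))" by simp
    qed (auto simp: finite_mabs_le)
    finally show ?thesis .
  qed
  also have "\<dots> = (\<Sum>p\<in>?P. \<Sum>k\<in>{k. k \<le> p - n}. row_vec (V (p - n - k)) (A k *v a p))"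
  proof (rule sum.cong[OF refl])
    fix p assume p: "p \<in> ?P"
    then have "mabs (p - n) \<le> N" using mabs_add[of "p - n" n] by (simp add: multi_add_diff)
    from arg_cong[OF recursion_identity[OF rec V0 this], of "\<lambda>V. row_vec V (a p)"]
    show "(\<Sum>k\<in>{k. k \<le> p - n}. row_vec (row_apply (L k) (V (p - n - k))) (a p))
        = (\<Sum>k\<in>{k. k \<le> p - n}. row_vec (V (p - n - k)) (A k *v a p))"
      by (simp add: row_vec_sum_left row_vec_row_mat)
  qed
  also have "\<dots> = (\<Sum>q\<in>?P. \<Sum>k\<in>{k. mabs (q + k) \<le> N}. row_vec (V (q - n)) (A k *v a (q + k)))"
  proof -
    have fin': "finite {k. mabs (q + k) \<le> N}" for q :: "nat ^ 'M"
      by (rule finite_subset[OF _ finite_mabs_le[of N]]) (auto simp: mabs_add)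
    have "(\<Sum>(p, k)\<in>Sigma ?P (\<lambda>p. {k. k \<le> p - n}). row_vec (V (p - n - k)) (A k *v a p))
        = (\<Sum>(q, k)\<in>Sigma ?P (\<lambda>q. {k. mabs (q + k) \<le> N}). row_vec (V (q - n)) (A k *v a (q + k)))"
    proof (rule sum.reindex_bij_witness[where i = "\<lambda>(q, k). (q + k, k)" and j = "\<lambda>(p, k). (p - k, k)"]; clarsimp)
      fix p k :: "nat ^ 'M" assume pk: "mabs p \<le> N" "n \<le> p" "k \<le> p - n"
      have c: "n $ i + k $ i \<le> p $ i" for i
        using pk by (simp add: less_eq_vec_def le_diff_conv2 add.commute)
      have "k \<le> p" using c add_leD2 unfolding less_eq_vec_def by blast
      then show 1: "p - k + k = p" by (rule multi_add_diff)
      have "mabs (p - k) + mabs k = mabs p" using 1 by (metis mabs_add)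
      then have "mabs (p - k) \<le> N" using pk(1) by simp
      moreover have "n $ i \<le> p $ i - k $ i" for i using c[of i] by arith
      then have "n \<le> p - k" by (simp add: less_eq_vec_def)
      ultimately show "mabs (p - k) \<le> N \<and> n \<le> p - k \<and> mabs (p - k + k) \<le> N"
        using 1 pk(1) by simp
      have "p - k - n = p - n - k" by (simp add: vec_eq_iff add.commute)
      then show "row_vec (V (p - k - n)) (A k *v a (p - k + k)) = row_vec (V (p - n - k)) (A k *v a p)"
        using 1 by simp
    next
      fix q k :: "nat ^ 'M" assume "mabs q \<le> N" "n \<le> q" "mabs (q + k) \<le> N"
      then have c: "n $ i \<le> q $ i" for i by (simp add: less_eq_vec_def)
      have "n $ i \<le> q $ i + k $ i" "k $ i \<le> q $ i + k $ i - n $ i" for i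
        using c[of i] by arith+
      then show "n \<le> q + k \<and> k \<le> q + k - n" by (simp add: less_eq_vec_def)
    qed
    then show ?thesis by (simp add: sum.Sigma fin fin' finite_multi_le)
  qed
  also have "(1 / mfact n) *\<^sub>R (\<Sum>q\<in>?P. \<Sum>k\<in>{k. mabs (q + k) \<le> N}. row_vec (V (q - n)) (A k *v a (q + k)))
      = gen_comb V N (centre_op N A a) n"
    by (simp add: gen_comb_apply centre_op_def row_vec_sum_right)
  finally show "gen_op L N (gen_comb V N a) n = gen_comb V N (centre_op N A a) n" .
qed

text \<open>Differentiating \<open>n\<close> times and setting \<open>\<xi> = 0\<close> leaves the rows \<open>V (p - n)\<close>. All of them
  except \<open>V 0\<close> are annihilated by \<open>Z\<close>, so \<open>Z\<close> recovers the centre coordinate of index \<open>n\<close>.\<close>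

lemma pair_xi_deriv_gen_comb:
  assumes rec: "recursion D L N Z A V" and Z: "gram Z (V 0) = mat 1" and n: "mabs n \<le> N"
  shows "pair Z (xi_deriv n (gen_comb V N a) 0) = a n"
proof -
  have fin: "finite {p. mabs p \<le> N \<and> n \<le> p}"
    by (rule finite_subset[OF _ finite_mabs_le[of N]]) auto
  have "pair Z (xi_deriv n (gen_comb V N a) 0) = (\<Sum>p\<in>{p. mabs p \<le> N \<and> n \<le> p}. gram Z (V (p - n)) *v a p)"
    by (simp add: xi_deriv_gen_comb mfact_def pair_row_vec linear_sum[OF bounded_linear.linear[OF bounded_linear_pair]])
  also have "\<dots> = (\<Sum>p\<in>{n}. gram Z (V (p - n)) *v a p)"
  proof (rule sum.mono_neutral_right[OF fin])
    show "\<forall>p\<in>{p. mabs p \<le> N \<and> n \<le> p} - {n}. gram Z (V (p - n)) *v a p = 0"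
    proof
      fix p assume p: "p \<in> {p. mabs p \<le> N \<and> n \<le> p} - {n}"
      have "p - n \<noteq> 0" using p multi_add_diff[of n p] by auto
      moreover have "mabs (p - n) \<le> N" using p mabs_add[of "p - n" n] by (simp add: multi_add_diff)
      ultimately have "gram Z (V (p - n)) = 0"
        using rec by (simp add: recursion_def mabs_eq_0 zero_less_iff_neq_zero)
      then show "gram Z (V (p - n)) *v a p = 0" by simp
    qed
  qed (use n in auto)
  also have "\<dots> = a n" by (simp add: Z)
  finally show ?thesis .
qed

lemma tendsto_fun_iff: "(f \<longlongrightarrow> l) F \<longleftrightarrow> (\<forall>n. ((\<lambda>x. f x n) \<longlongrightarrow> l n) F)"
  using limitin_componentwise[of "\<lambda>_. euclidean" UNIV f l F]
  by (simp add: euclidean_product_topology)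

lemma gen_comb_add: "gen_comb V N (a + b) = gen_comb V N a + gen_comb V N b"
  by (simp add: gen_comb_def scaleR_add_left sum.distrib)

lemma gen_comb_scaleR: "gen_comb V N (r *\<^sub>R a) = r *\<^sub>R gen_comb V N a"
  by (simp add: gen_comb_def fun_scaleR_apply scaleR_sum_right)

lemma subspace_multinomials: "subspace (multinomials N)"
  by (auto simp: subspace_def multinomials_def fun_scaleR_apply)

lemma xi_deriv_0: "xi_deriv 0 c = c"
  by (simp add: xi_deriv_def fun_eq_iff mfact_nonzero)

context
  fixes V :: "nat ^ 'M::finite \<Rightarrow> 'u::real_normed_vector ^ 'm::finite"
    and N :: nat and W :: "'s::banach \<Rightarrow> nat ^ 'M \<Rightarrow> 'u"
  assumes basis: "complete_basis V N W"
begin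

lemma W_linear: "linear W"
  using basis by (simp add: complete_basis_def)

lemma zero_multinomial: "(0 :: nat ^ 'M \<Rightarrow> real ^ 'm) \<in> multinomials N"
  by (simp add: multinomials_def)

lemma gen_comb_zero: "gen_comb V N 0 = 0"
  by (simp add: gen_comb_def)

lemma coordinate_map:
  obtains coords where
    "\<And>a s. a \<in> multinomials N \<Longrightarrow> coords (gen_comb V N a + W s) = (a, s)"
    "\<And>a s. a \<in> multinomials N \<Longrightarrow> gen_comb V N a + W s \<in> multinomials N"
    "\<And>c. c \<in> multinomials N \<Longrightarrow> \<exists>a s. a \<in> multinomials N \<and> c = gen_comb V N a + W s"
    "continuous_on (multinomials N) coords"
    "continuous_on (multinomials N \<times> UNIV) (\<lambda>(a, s). gen_comb V N a + W s)"
proof -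
  let ?\<Phi> = "\<lambda>(a, s). gen_comb V N a + W s"
  obtain coords where h: "homeomorphism (multinomials N \<times> UNIV) (multinomials N) ?\<Phi> coords"
    using basis unfolding complete_basis_def by (elim conjE exE)
  have mem: "(a, s) \<in> multinomials N \<times> UNIV" if "a \<in> multinomials N"
    for a :: "nat ^ 'M \<Rightarrow> real ^ 'm" and s :: 's using that by simp
  show thesis
  proof (rule that)
    show "coords (gen_comb V N a + W s) = (a, s)" if "a \<in> multinomials N" for a s
      using homeomorphism_apply1[OF h mem[OF that]] by simp
    show "gen_comb V N a + W s \<in> multinomials N" if "a \<in> multinomials N" for a s
      using imageI[OF mem[OF that], of ?\<Phi>] unfolding homeomorphism_image1[OF h] by simp
    show "\<exists>a s. a \<in> multinomials N \<and> c = gen_comb V N a + W s" if "c \<in> multinomials N" for c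
    proof (intro exI conjI)
      have "coords c \<in> multinomials N \<times> UNIV" using imageI[OF that, of coords] unfolding homeomorphism_image2[OF h] .
      then show "fst (coords c) \<in> multinomials N" by auto
      show "c = gen_comb V N (fst (coords c)) + W (snd (coords c))"
        using homeomorphism_apply2[OF h that] by (simp add: case_prod_beta)
    qed
  qed (rule homeomorphism_cont2[OF h] homeomorphism_cont1[OF h])+
qed

lemma coordinates_exist:
  assumes "c \<in> multinomials N"
  obtains a s where "a \<in> multinomials N" "c = gen_comb V N a + W s"
  by (rule coordinate_map) (use assms that in blast)

text \<open>Applied to difference quotients, this transfers differentiability from a curve of multinomials,
  which is a coefficientwise notion, to its stable coordinate in a Banach space.\<close>

lemma coordinates_tendsto:
  assumes "(c \<longlongrightarrow> c') F" "\<And>x. c x = gen_comb V N (a x) + W (s x)" "c' = gen_comb V N a' + W s'"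
    "\<And>x. a x \<in> multinomials N" "a' \<in> multinomials N"
  shows "(s \<longlongrightarrow> s') F"
proof (rule coordinate_map)
  fix coords
  assume eq: "\<And>a s. a \<in> multinomials N \<Longrightarrow> coords (gen_comb V N a + W s) = (a, s)"
    and mem: "\<And>a s. a \<in> multinomials N \<Longrightarrow> gen_comb V N a + W s \<in> multinomials N"
    and cont: "continuous_on (multinomials N) coords"
  have "((\<lambda>x. coords (c x)) \<longlongrightarrow> coords c') F"
    by (rule continuous_on_tendsto_compose[OF cont assms(1)])
      (simp_all add: assms(2-5) mem)
  then have "((\<lambda>x. snd (coords (c x))) \<longlongrightarrow> snd (coords c')) F" by (rule tendsto_snd)
  then show ?thesis by (simp add: assms(2-5) eq)
qed

text \<open>Coefficient families carry no norm, only the product topology; continuity at \<open>0\<close> of each single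
  coefficient is what yields a bound.\<close>

lemma bounded_linear_W: "bounded_linear (\<lambda>s. W s n)"
proof -
  have cont: "continuous_on (multinomials N \<times> UNIV) (\<lambda>(a, s). gen_comb V N a + W s)"
    by (rule coordinate_map)
  have "continuous_on UNIV (\<lambda>s. (\<lambda>(a, s). gen_comb V N a + W s) (0 :: nat ^ 'M \<Rightarrow> real ^ 'm, s))"
    by (rule continuous_on_compose2[OF cont])
      (auto intro!: continuous_intros simp: zero_multinomial)
  then have "continuous_on UNIV (\<lambda>s. W s)" by (simp add: gen_comb_zero)
  then have "continuous_on UNIV (\<lambda>s. W s n)" by (rule continuous_on_product_then_coordinatewise)
  then have "isCont (\<lambda>s. W s n) 0" by (simp add: continuous_on_eq_continuous_at)
  then obtain d where d: "0 < d" "\<And>s. dist s 0 < d \<Longrightarrow> dist (W s n) (W 0 n) < 1"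
    unfolding continuous_at_eps_delta using zero_less_one by blast
  have lin: "W (x + y) n = W x n + W y n" "W (r *\<^sub>R x) n = r *\<^sub>R W x n" for x y r
    using linear_add[OF W_linear] linear_scale[OF W_linear] by (simp_all add: fun_scaleR_apply)
  have W0: "W 0 n = 0" using linear_0[OF W_linear] by simp
  show ?thesis
  proof (rule bounded_linear_intro[where K = "2 / d"])
    fix s
    show "norm (W s n) \<le> norm s * (2 / d)"
    proof (cases "s = 0")
      case False
      let ?r = "d / (2 * norm s)"
      have r: "0 < ?r" using d False by simp
      have "norm (?r *\<^sub>R s) < d" using d(1) False by simp
      then have "norm (W (?r *\<^sub>R s) n) < 1" using d(2)[of "?r *\<^sub>R s"] by (simp add: W0)
      then have "?r * norm (W s n) < 1" using r d(1) by (simp add: lin)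
      then have "norm (W s n) < 1 / ?r" using pos_less_divide_eq[OF r, of "norm (W s n)" 1] by (simp only: mult.commute)
      then show ?thesis by (simp add: mult.commute)
    qed (simp add: W0)
  qed (simp_all add: lin)
qed

end

section \<open>Evolution of the field at a station\<close>

text \<open>The Taylor polynomial of the field at the station \<open>X\<close>, with the displacement from \<open>X\<close> replaced by
  the indeterminate.\<close>

definition gen_field :: "nat \<Rightarrow> (real ^ 'M::finite \<Rightarrow> 'u::real_normed_vector) \<Rightarrow> real ^ 'M \<Rightarrow> nat ^ 'M \<Rightarrow> 'u"
  where "gen_field N f X = (\<lambda>n. if mabs n \<le> N then (1 / mfact n) *\<^sub>R mderiv n f X else 0)"

lemma gen_field_multinomial: "gen_field N f X \<in> multinomials N"
  by (simp add: gen_field_def multinomials_def)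

lemma xi_deriv_gen_field:
  "xi_deriv k (gen_field N f X) n = (if mabs (n + k) \<le> N then (1 / mfact n) *\<^sub>R mderiv (n + k) f X else 0)"
  using mfact_nonzero[of "n + k"] by (simp add: xi_deriv_def gen_field_def)

context
  fixes D :: "nat ^ 'M::finite \<Rightarrow> 'u::{real_inner, banach} set" and L :: "nat ^ 'M \<Rightarrow> 'u \<Rightarrow> 'u"
    and N :: nat and S :: "(real ^ 'M) set" and u :: "real ^ 'M \<Rightarrow> real \<Rightarrow> 'u" and X :: "real ^ 'M"
  assumes N: "1 \<le> N" and S: "open S" and X: "X \<in> S"
    and closed_ops: "\<And>k. closed_op (D k) (L k)" and support: "finite (op_support D L)"
    and solution: "pde_solution D L N S u"
begin

lemma ops_linear: "linear_op (D k) (L k)"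
  using closed_ops by (simp add: closed_op_def)

lemma not_op_support: "k \<notin> op_support D L \<Longrightarrow> D k = UNIV \<and> L k v = 0"
  by (auto simp: op_support_def)

text \<open>The orders of differentiability that the solution concept provides: \<open>2 * N\<close>, and \<open>N\<close> more than
  every operator in the equation consumes.\<close>

lemma field_Ck_joint:
  assumes "j \<le> 2 * N \<or> (\<exists>k\<in>op_support D L. j \<le> N + mabs k)"
  shows "Ck_on j (S \<times> UNIV) (\<lambda>(x, t). u x t)"
proof -
  obtain r where r: "2 * N \<le> r" "\<And>k. k \<in> op_support D L \<Longrightarrow> N + mabs k \<le> r"
    "Ck_on r (S \<times> UNIV) (\<lambda>(x, t). u x t)"
    using solution by (auto simp: pde_solution_def)
  have "j \<le> r" using assms r(1,2) by (meson le_trans)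
  then show ?thesis using r(3) by (rule Ck_on_mono)
qed

lemma field_Ck:
  assumes "j \<le> 2 * N \<or> (\<exists>k\<in>op_support D L. j \<le> N + mabs k)"
  shows "Ck_on j S (\<lambda>x. u x t)"
  using Ck_on_slice[OF S field_Ck_joint[OF assms], of t] by simp

lemma term_Ck: "k \<in> op_support D L \<Longrightarrow> Ck_on N S (\<lambda>x. L k (mderiv k (\<lambda>x. u x t) x))"
  using solution by (simp add: pde_solution_def)

text \<open>The equation may be differentiated up to \<open>N\<close> times in space: closedness lets each operator commute
  with the derivatives, and shows that it can be applied to the derivatives at all.\<close>

lemma field_derivative_op:
  assumes k: "k \<in> op_support D L" and n: "mabs n \<le> N"
  shows "mderiv (n + k) (\<lambda>x. u x t) X \<in> D k"
    "L k (mderiv (n + k) (\<lambda>x. u x t) X) = mderiv n (\<lambda>x. L k (mderiv k (\<lambda>x. u x t) x)) X"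
proof -
  have C: "Ck_on (mabs n + mabs k) S (\<lambda>x. u x t)" using k n by (intro field_Ck disjI2 bexI[of _ k]) auto
  have "Ck_on (mabs k + mabs n) S (\<lambda>x. u x t)" using C by (simp add: add.commute)
  then have C': "Ck_on (mabs n) S (mderiv k (\<lambda>x. u x t))" by (rule Ck_on_mderiv)
  have dom: "mderiv k (\<lambda>x. u x t) x \<in> D k" if "x \<in> S" for x
    using solution k that by (simp add: pde_solution_def)
  note * = closed_op_mderiv[OF closed_ops S C' Ck_on_mono[OF n term_Ck[OF k]] dom X]
  show "mderiv (n + k) (\<lambda>x. u x t) X \<in> D k"
    "L k (mderiv (n + k) (\<lambda>x. u x t) X) = mderiv n (\<lambda>x. L k (mderiv k (\<lambda>x. u x t) x)) X"
    using * by (simp_all add: mderiv_add[OF S C X])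
qed

lemma gen_field_in_gen_dom: "gen_field N (\<lambda>x. u x t) X \<in> gen_dom D N"
proof -
  have "xi_deriv k (gen_field N (\<lambda>x. u x t) X) n \<in> D k" for k n
  proof (cases "k \<in> op_support D L")
    case True
    have "(1 / mfact n) *\<^sub>R mderiv (n + k) (\<lambda>x. u x t) X \<in> D k" if "mabs (n + k) \<le> N"
      using that by (intro linear_op_scaleR(1)[OF ops_linear] field_derivative_op(1)[OF True]) (simp add: mabs_add)
    then show ?thesis by (simp add: xi_deriv_gen_field linear_op_zero(1)[OF ops_linear])
  qed (simp add: not_op_support)
  then show ?thesis by (simp add: gen_dom_def gen_field_multinomial)
qed

lemma field_derivative_evolution:
  assumes n: "mabs n \<le> N"
  shows "((\<lambda>t. mderiv n (\<lambda>x. u x t) X) has_vector_derivative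
    (\<Sum>k\<in>op_support D L. L k (mderiv (n + k) (\<lambda>x. u x t) X))) (at t)"
proof -
  have "((\<lambda>t. mderiv n (\<lambda>x. u x t) X) has_vector_derivative
      mderiv n (\<lambda>x. \<Sum>k\<in>op_support D L. L k (mderiv k (\<lambda>x. u x t) x)) X) (at t)"
  proof (rule time_derivative_mderiv[OF S _ _ X])
    show "Ck_on (Suc (mabs n)) (S \<times> UNIV) (\<lambda>(x, t). u x t)" using n N by (intro field_Ck_joint) auto
  qed (use solution in \<open>simp add: pde_solution_def\<close>)
  also have "mderiv n (\<lambda>x. \<Sum>k\<in>op_support D L. L k (mderiv k (\<lambda>x. u x t) x)) X
      = (\<Sum>k\<in>op_support D L. mderiv n (\<lambda>x. L k (mderiv k (\<lambda>x. u x t) x)) X)"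
    by (rule mderiv_sum[OF S Ck_on_mono[OF n term_Ck] X])
  also have "\<dots> = (\<Sum>k\<in>op_support D L. L k (mderiv (n + k) (\<lambda>x. u x t) X))"
    by (intro sum.cong refl) (simp add: field_derivative_op(2) n)
  finally show ?thesis .
qed

text \<open>The sum over all operators splits according to the order of \<open>n + k\<close>: orders up to \<open>N\<close> are the
  derivatives stored in the multinomial and form \<open>gen_op\<close>, higher orders are the coupling term.\<close>

lemma gen_field_evolution:
  "((\<lambda>t. gen_field N (\<lambda>x. u x t) X n) has_vector_derivative
    (gen_op L N (gen_field N (\<lambda>x. u x t) X) + coupling D L N (\<lambda>x. u x t) X) n) (at t)"
proof (cases "mabs n \<le> N")
  case False
  show ?thesis using False
    by (simp add: gen_field_def coupling_def gen_op_def xi_deriv_def mabs_add linear_op_zero(2)[OF ops_linear])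
next
  case n: True
  let ?f = "\<lambda>x. u x t"
  have "gen_op L N (gen_field N ?f X) n
      = (\<Sum>k\<in>{k \<in> op_support D L. mabs (k + n) \<le> N}. (1 / mfact n) *\<^sub>R L k (mderiv (n + k) ?f X))"
    unfolding gen_op_def xi_deriv_gen_field
  proof (rule sum.mono_neutral_cong_right)
    show "{k \<in> op_support D L. mabs (k + n) \<le> N} \<subseteq> {k. mabs k \<le> N}" by (auto simp: mabs_add)
    show "\<forall>k\<in>{k. mabs k \<le> N} - {k \<in> op_support D L. mabs (k + n) \<le> N}.
        L k (if mabs (n + k) \<le> N then (1 / mfact n) *\<^sub>R mderiv (n + k) ?f X else 0) = 0"
      using not_op_support by (auto simp: linear_op_zero(2)[OF ops_linear] add.commute)
    show "L k (if mabs (n + k) \<le> N then (1 / mfact n) *\<^sub>R mderiv (n + k) ?f X else 0)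
        = (1 / mfact n) *\<^sub>R L k (mderiv (n + k) ?f X)"
      if "k \<in> {k \<in> op_support D L. mabs (k + n) \<le> N}" for k
      using that linear_op_scaleR(2)[OF ops_linear field_derivative_op(1)[of k n t]] n by (simp add: add.commute)
  qed (rule finite_mabs_le)
  moreover have "coupling D L N ?f X n
      = (\<Sum>k\<in>{k \<in> op_support D L. N < mabs (k + n)}. (1 / mfact n) *\<^sub>R L k (mderiv (n + k) ?f X))"
  proof -
    have "coupling_coeff D L N ?f X n = (\<Sum>k\<in>{k \<in> op_support D L. N < mabs (k + n)}. L k (mderiv (k + n) ?f X))"
    proof (rule coupling_coeff_eq[OF S X N support ops_linear n])
      show "Ck_on (mabs (k + n)) S ?f" if "k \<in> op_support D L" for k
        using that n by (intro field_Ck disjI2 bexI[of _ k]) (auto simp: mabs_add)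
      show "mderiv (k + n) ?f X \<in> D k" if "k \<in> op_support D L" for k
        using field_derivative_op(1)[OF that n] by (simp add: add.commute)
    qed
    then show ?thesis using n by (simp add: coupling_def scaleR_sum_right add.commute)
  qed
  moreover have "(\<Sum>k\<in>op_support D L. (1 / mfact n) *\<^sub>R L k (mderiv (n + k) ?f X))
      = (\<Sum>k\<in>{k \<in> op_support D L. mabs (k + n) \<le> N}. (1 / mfact n) *\<^sub>R L k (mderiv (n + k) ?f X))
      + (\<Sum>k\<in>{k \<in> op_support D L. N < mabs (k + n)}. (1 / mfact n) *\<^sub>R L k (mderiv (n + k) ?f X))"
    using support by (subst sum.union_disjoint[symmetric]) (auto intro!: sum.cong)
  ultimately have "(gen_op L N (gen_field N ?f X) + coupling D L N ?f X) n
      = (1 / mfact n) *\<^sub>R (\<Sum>k\<in>op_support D L. L k (mderiv (n + k) ?f X))"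
    by (simp add: scaleR_sum_right)
  moreover have "((\<lambda>t. (1 / mfact n) *\<^sub>R mderiv n (\<lambda>x. u x t) X) has_vector_derivative
      (1 / mfact n) *\<^sub>R (\<Sum>k\<in>op_support D L. L k (mderiv (n + k) ?f X))) (at t)"
    by (rule bounded_linear.has_vector_derivative[OF bounded_linear_scaleR_right field_derivative_evolution[OF n]])
  ultimately show ?thesis using n by (simp add: gen_field_def)
qed

lemma mderiv_pair_field:
  assumes "mabs n \<le> N"
  shows "mderiv n (\<lambda>x. pair Z (u x t)) X = pair Z (xi_deriv n (gen_field N (\<lambda>x. u x t) X) 0)"
proof -
  have "Ck_on (mabs n) S (\<lambda>x. u x t)" using assms by (intro field_Ck) auto
  from mderiv_bounded_linear[OF S bounded_linear_pair this X]
  show ?thesis using assms by (simp add: xi_deriv_gen_field mfact_def)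
qed

end

text \<open>The coordinates of the two subspaces decouple: the centre columns and the range of \<open>W\<close> are both
  invariant, so comparing coordinates in the evolution of \<open>c\<close> gives an inhomogeneous equation with
  generator \<open>B\<close> for the stable coordinate alone.\<close>

lemma coordinates_evolution:
  fixes V :: "nat ^ 'M::finite \<Rightarrow> 'u::{real_inner, banach} ^ 'm::finite" and W :: "'s::banach \<Rightarrow> nat ^ 'M \<Rightarrow> 'u"
  assumes basis: "complete_basis V N W"
    and lin: "\<And>k. linear_op (D k) (L k)"
    and rec: "recursion D L N Z A V" and V0: "row_apply (L 0) (V 0) = row_mat (V 0) (A 0)"
    and DB: "DB = {s. W s \<in> gen_dom D N}" and B: "\<And>s. s \<in> DB \<Longrightarrow> gen_op L N (W s) = W (B s)"
    and c: "\<And>t. c t \<in> gen_dom D N"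
    and c': "\<And>t n. ((\<lambda>t. c t n) has_vector_derivative (gen_op L N (c t) + r t) n) (at t)"
    and r: "\<And>t. rc t \<in> multinomials N" "\<And>t. r t = gen_comb V N (rc t) + W (rs t)"
  shows "\<exists>a s. \<forall>t. c t = gen_comb V N (a t) + W (s t) \<and> s t \<in> DB \<and>
    (s has_vector_derivative B (s t) + rs t) (at t) \<and>
    gen_op L N (c t) + r t = gen_comb V N (centre_op N A (a t) + rc t) + W (B (s t) + rs t)"
proof -
  note W_lin = W_linear[OF basis]
  have "c t \<in> multinomials N" for t using c[of t] by (simp add: gen_dom_def)
  then have "\<exists>a s. a \<in> multinomials N \<and> c t = gen_comb V N a + W s" for t
    using coordinates_exist[OF basis] by metis
  then obtain a s where a: "\<And>t. a t \<in> multinomials N" and cs: "\<And>t. c t = gen_comb V N (a t) + W (s t)"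
    by metis
  have a_dom: "gen_comb V N (a t) \<in> gen_dom D N" for t
    by (rule gen_comb_in_gen_dom[OF lin]) (use rec in \<open>simp add: recursion_def\<close>)
  have s: "s t \<in> DB" for t
    using linear_op_diff(1)[OF linear_op_gen_op[OF lin] c[of t] a_dom[of t]] by (simp add: DB cs)
  have rhs: "gen_op L N (c t) + r t = gen_comb V N (centre_op N A (a t) + rc t) + W (B (s t) + rs t)" for t
  proof -
    have "linear_op (gen_dom D N) (gen_op L N)" by (rule linear_op_gen_op[OF lin])
    then have "gen_op L N (c t) = gen_op L N (gen_comb V N (a t)) + gen_op L N (W (s t))"
      using a_dom[of t] s[of t] unfolding linear_op_def DB cs by blast
    then show ?thesis
      by (simp add: gen_op_gen_comb[OF lin rec V0] B[OF s] r(2) gen_comb_add linear_add[OF W_lin] algebra_simps)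
  qed
  have "(s has_vector_derivative B (s t) + rs t) (at t)" for t
    unfolding has_vector_derivative_within_quotient
  proof (rule coordinates_tendsto[OF basis])
    show "((\<lambda>y. (c y - c t) /\<^sub>R (y - t)) \<longlongrightarrow> gen_op L N (c t) + r t) (at t)"
      using c'[of _ t] unfolding has_vector_derivative_within_quotient
      by (simp add: tendsto_fun_iff fun_scaleR_apply)
    show "(c y - c t) /\<^sub>R (y - t) = gen_comb V N ((a y - a t) /\<^sub>R (y - t)) + W ((s y - s t) /\<^sub>R (y - t))" for y
    proof -
      have "gen_comb V N (a y - a t) = gen_comb V N (a y) - gen_comb V N (a t)"
        using gen_comb_add[of V N "a y - a t" "a t"] by (simp add: algebra_simps)
      then show ?thesis
        by (simp add: cs gen_comb_scaleR linear_scale[OF W_lin] linear_diff[OF W_lin] scaleR_add_right[symmetric])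
    qed
    show "(a y - a t) /\<^sub>R (y - t) \<in> multinomials N" for y
      using a by (intro subspace_scale[OF subspace_multinomials] subspace_diff[OF subspace_multinomials])
    show "centre_op N A (a t) + rc t \<in> multinomials N"
      by (intro subspace_add[OF subspace_multinomials] centre_op_multinomial r)
  qed (rule rhs)
  then show ?thesis using cs s rhs by blast
qed

section \<open>The macroscale equation\<close>

lemma semigroup_exponential_bound:
  assumes "spectrum_determined_growth DB B T" "\<And>\<mu>. is_eigenvalue DB B \<mu> \<Longrightarrow> Re \<mu> \<le> - \<beta>" "\<gamma> < \<beta>"
  obtains C where "0 \<le> C" "\<And>t x. 0 \<le> t \<Longrightarrow> norm (T t x) \<le> C * exp (- \<gamma> * t) * norm x"
proof -
  have "- \<beta> < - \<gamma>" using assms(3) by simp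
  moreover have "(\<forall>\<mu>. is_eigenvalue DB B \<mu> \<longrightarrow> Re \<mu> \<le> - \<beta>) \<longrightarrow>
      (\<forall>b'>- \<beta>. \<exists>C. \<forall>t\<ge>0. \<forall>x. norm (T t x) \<le> C * exp (b' * t) * norm x)"
    using assms(1) unfolding spectrum_determined_growth_def by (rule spec)
  then have "\<forall>b'>- \<beta>. \<exists>C. \<forall>t\<ge>0. \<forall>x. norm (T t x) \<le> C * exp (b' * t) * norm x"
    by (rule mp) (use assms(2) in simp)
  ultimately obtain C where C: "\<And>t x. 0 \<le> t \<Longrightarrow> norm (T t x) \<le> C * exp (- \<gamma> * t) * norm x"
    by meson
  have bound: "norm (T t x) \<le> \<bar>C\<bar> * exp (- \<gamma> * t) * norm x" if "0 \<le> t" for t x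
  proof -
    have "C * exp (- \<gamma> * t) * norm x \<le> \<bar>C\<bar> * exp (- \<gamma> * t) * norm x"
      by (intro mult_right_mono) auto
    with C[OF that, of x] show ?thesis by linarith
  qed
  show thesis by (rule that[OF abs_ge_zero bound])
qed

lemma bigo_exponential_bound:
  assumes "\<And>t. 0 \<le> t \<Longrightarrow> norm (f t :: 'a::real_normed_vector) \<le> K * exp (- \<gamma> * t)"
  shows "(\<lambda>t. norm (f t)) \<in> O[at_top](\<lambda>t. exp (- \<gamma> * t))"
proof (rule bigoI[where c = K])
  show "\<forall>\<^sub>F t in at_top. norm (norm (f t)) \<le> K * norm (exp (- \<gamma> * t))"
    using eventually_ge_at_top[of 0] by eventually_elim (use assms in simp)
qed

lemma bounded_linear_stable_output:
  fixes V :: "nat ^ 'M::finite \<Rightarrow> 'u::{real_inner, banach} ^ 'm::finite"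
    and W :: "'s::banach \<Rightarrow> nat ^ 'M \<Rightarrow> 'u" and A :: "nat ^ 'M \<Rightarrow> real ^ 'm ^ 'm"
  assumes "complete_basis V N W"
  shows "bounded_linear (\<lambda>s. \<Sum>n\<in>K. A n *v pair Z (xi_deriv n (W s) 0))"
  unfolding xi_deriv_def
  by (intro bounded_linear_sum
      bounded_linear_compose[OF linear_conv_bounded_linear[THEN iffD1, OF matrix_vector_mul_linear]]
      bounded_linear_compose[OF bounded_linear_pair]
      bounded_linear_compose[OF bounded_linear_scaleR_right bounded_linear_W[OF assms]])

theorem proposition1:
  fixes D :: "nat ^ 'M::finite \<Rightarrow> 'u::{real_inner, banach} set"
    and L :: "nat ^ 'M \<Rightarrow> 'u \<Rightarrow> 'u"
    and N :: nat
    and \<alpha> \<beta> :: real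
    and J :: "nat set"
    and ev :: "'m::finite + nat \<Rightarrow> complex"
    and v :: "'m + nat \<Rightarrow> 'u"
    and Ec Es :: "'u set"
    and Z :: "'u ^ 'm"
    and A :: "nat ^ 'M \<Rightarrow> real ^ 'm ^ 'm"
    and V :: "nat ^ 'M \<Rightarrow> 'u ^ 'm"
    and W :: "'s::banach \<Rightarrow> nat ^ 'M \<Rightarrow> 'u"
    and DB :: "'s set"
    and B :: "'s \<Rightarrow> 's"
    and T :: "real \<Rightarrow> 's \<Rightarrow> 's"
    and S :: "(real ^ 'M) set"
    and u :: "real ^ 'M \<Rightarrow> real \<Rightarrow> 'u"
    and U :: "real ^ 'M \<Rightarrow> real \<Rightarrow> real ^ 'm"
    and rc :: "real ^ 'M \<Rightarrow> real \<Rightarrow> nat ^ 'M \<Rightarrow> real ^ 'm"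
    and rs :: "real ^ 'M \<Rightarrow> real \<Rightarrow> 's"
  assumes "1 \<le> N"
    and "open S"
    and operators: "\<And>k. closed_op (D k) (L k)" "finite (op_support D L)"
    and solution: "pde_solution D L N S u"
    and spectral: "spectral_assumption (D 0) (L 0) N \<alpha> \<beta> J ev v Ec Es"
    and eigendata: "basic_eigendata (D 0) (L 0) \<alpha> v (V 0) (A 0) Z"
    and recursion: "recursion D L N Z A V"
    and stable_basis: "range W = spectral_subspace (gen_dom D N) (gen_op L N) (\<lambda>\<mu>. Re \<mu> \<le> - \<beta>)"
      "complete_basis V N W"
    and B_domain: "DB = {s. W s \<in> gen_dom D N}"
    and B: "\<And>s. s \<in> DB \<Longrightarrow> gen_op L N (W s) = W (B s)"
    and B_eigenvalues: "\<And>\<mu>. is_eigenvalue DB B \<mu> \<Longrightarrow> Re \<mu> \<le> - \<beta>"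
    and exp_B: "generates_on UNIV DB B T" "spectrum_determined_growth DB B T"
    and U: "\<And>x t. U x t = pair Z (u x t)"
    and coordinates: "\<And>X t. X \<in> S \<Longrightarrow> rc X t \<in> multinomials N"
      "\<And>X t. X \<in> S \<Longrightarrow>
        coupling D L N (\<lambda>x. u x t) X = gen_comb V N (rc X t) + W (rs X t)"
  shows "\<forall>X\<in>S.
    (\<forall>t. U X differentiable (at t)) \<and>
    (\<forall>t\<ge>0. (\<lambda>\<tau>. T (t - \<tau>) (rs X \<tau>)) integrable_on {0..t} \<and> conv T (rs X) t \<in> DB) \<and>
    (\<exists>\<gamma>. \<alpha> < \<gamma> \<and> \<gamma> < \<beta> \<and>
      (\<lambda>t. norm (vector_derivative (U X) (at t)
        - ((\<Sum>n\<in>{n. mabs n \<le> N}. A n *v mderiv n (\<lambda>x. U x t) X)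
           + remainder Z A V N W B T (rc X) (rs X) t)))
      \<in> O[at_top](\<lambda>t. exp (- \<gamma> * t)))"
proof
  fix X assume X: "X \<in> S"
  let ?c = "\<lambda>t. gen_field N (\<lambda>x. u x t) X" and ?r = "\<lambda>t. coupling D L N (\<lambda>x. u x t) X"
  let ?K = "{n :: nat ^ 'M. mabs n \<le> N}"
  note field = \<open>1 \<le> N\<close> \<open>open S\<close> X operators solution
  have lin: "linear_op (D k) (L k)" for k using operators(1) by (simp add: closed_op_def)
  have V0: "row_apply (L 0) (V 0) = row_mat (V 0) (A 0)" and Z: "gram Z (V 0) = mat 1"
    using eigendata by (auto simp: basic_eigendata_def)
  note W_lin = W_linear[OF stable_basis(2)]
  obtain a s where evolution: "\<And>t. ?c t = gen_comb V N (a t) + W (s t) \<and> s t \<in> DB \<and>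
      (s has_vector_derivative B (s t) + rs X t) (at t) \<and>
      gen_op L N (?c t) + ?r t = gen_comb V N (centre_op N A (a t) + rc X t) + W (B (s t) + rs X t)"
    using coordinates_evolution[OF stable_basis(2) lin recursion V0 B_domain B gen_field_in_gen_dom[OF field]
          gen_field_evolution[OF field] coordinates[OF X]] by blast
  have cs: "?c t = gen_comb V N (a t) + W (s t)" and s: "s t \<in> DB"
    and s': "(s has_vector_derivative B (s t) + rs X t) (at t)"
    and c': "gen_op L N (?c t) + ?r t = gen_comb V N (centre_op N A (a t) + rc X t) + W (B (s t) + rs X t)" for t
    using evolution[of t] by auto
  have "0 \<le> \<alpha>"
  proof -
    \<comment> \<open>the index type of the centre eigenvalues is inhabited, which makes \<open>\<alpha>\<close> nonnegative\<close>
    have "\<bar>Re (ev (Inl undefined))\<bar> \<le> \<alpha>" using spectral by (simp add: spectral_assumption_def)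
    then show ?thesis using abs_ge_zero order_trans by blast
  qed
  moreover have "real N * \<alpha> < \<beta>" using spectral by (simp add: spectral_assumption_def)
  moreover have "\<alpha> \<le> real N * \<alpha>" using mult_right_mono[of 1 "real N" \<alpha>] \<open>0 \<le> \<alpha>\<close> \<open>1 \<le> N\<close> by simp
  ultimately have "\<alpha> < \<beta>" by linarith
  then obtain \<gamma> where \<gamma>: "\<alpha> < \<gamma>" "\<gamma> < \<beta>" using dense by blast
  obtain C where C: "0 \<le> C" "\<And>t x. 0 \<le> t \<Longrightarrow> norm (T t x) \<le> C * exp (- \<gamma> * t) * norm x"
    using semigroup_exponential_bound[OF exp_B(2) B_eigenvalues \<gamma>(2)] by blast
  \<comment> \<open>\<open>\<gamma>\<close> is positive, so the exponential bound is also a uniform one\<close>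
  have bounded: "norm (T t x) \<le> C * norm x" if "0 \<le> t" for t x
  proof -
    have "exp (- \<gamma> * t) \<le> 1" using \<gamma>(1) \<open>0 \<le> \<alpha>\<close> that by simp
    then have "C * exp (- \<gamma> * t) * norm x \<le> C * 1 * norm x" using C(1) by (intro mult_right_mono mult_left_mono) auto
    with C(2)[OF that, of x] show ?thesis by simp
  qed
  note semigroup = exp_B(1) bounded
  have integral: "((\<lambda>\<tau>. T (t - \<tau>) (rs X \<tau>)) has_integral (s t - T t (s 0))) {0..t}" if "0 \<le> t" for t
    by (rule variation_of_constants[OF semigroup that s s'])
  then have conv: "conv T (rs X) t = s t - T t (s 0)" if "0 \<le> t" for t
    unfolding conv_def using that by (intro integral_unique)
  have transient: "T t (s 0) \<in> DB" "B (T t (s 0)) = T t (B (s 0))" if "0 \<le> t" for t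
    using semigroup_generator_commute[OF semigroup s that] by auto
  have conv_DB: "s t - T t (s 0) \<in> DB" "B (s t - T t (s 0)) = B (s t) - B (T t (s 0))" if "0 \<le> t" for t
    by (rule generator_diff[OF semigroup s transient(1)[OF that]]; assumption)+
  have U': "(U X has_vector_derivative pair Z ((gen_op L N (?c t) + ?r t) 0)) (at t)" for t
  proof -
    have "mabs (0 :: nat ^ 'M) \<le> N" by (simp add: mabs_def)
    then have "U X = (\<lambda>t. pair Z (?c t 0))" by (simp add: U fun_eq_iff gen_field_def mfact_def mderiv_0)
    then show ?thesis
      using bounded_linear.has_vector_derivative[OF bounded_linear_pair gen_field_evolution[OF field]] by simp
  qed
  let ?E1 = "\<lambda>z. pair Z (W z 0)" and ?E2 = "\<lambda>z. \<Sum>n\<in>?K. A n *v pair Z (xi_deriv n (W z) 0)"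
  have E1: "bounded_linear ?E1"
    by (rule bounded_linear_compose[OF bounded_linear_pair bounded_linear_W[OF stable_basis(2)]])
  have E2: "bounded_linear ?E2" by (rule bounded_linear_stable_output[OF stable_basis(2)])
  \<comment> \<open>everything driven by the centre coordinates and by the coupling cancels; the orbit of the initial stable coordinate remains\<close>
  have error: "vector_derivative (U X) (at t)
      - ((\<Sum>n\<in>?K. A n *v mderiv n (\<lambda>x. U x t) X) + remainder Z A V N W B T (rc X) (rs X) t)
      = ?E1 (T t (B (s 0))) - ?E2 (T t (s 0))" if t: "0 \<le> t" for t
  proof -
    have "pair Z (gen_comb V N (centre_op N A (a t)) 0) = centre_op N A (a t) 0"
      using pair_xi_deriv_gen_comb[OF recursion Z, of 0] by (simp add: xi_deriv_0 mabs_def)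
    then have "vector_derivative (U X) (at t)
        = (\<Sum>n\<in>?K. A n *v a t n) + pair Z (gen_comb V N (rc X t) 0) + (?E1 (B (s t)) + ?E1 (rs X t))"
      unfolding vector_derivative_at[OF U'] c'
      by (simp add: gen_comb_add linear_add[OF W_lin]
          linear_simps(1)[OF bounded_linear_pair] centre_op_def)
    moreover have "(\<Sum>n\<in>?K. A n *v mderiv n (\<lambda>x. U x t) X) = (\<Sum>n\<in>?K. A n *v a t n) + ?E2 (s t)"
    proof -
      \<comment> \<open>the spatial derivatives of \<open>U\<close> are the centre coordinates up to a stable contribution\<close>
      have "mderiv n (\<lambda>x. U x t) X = a t n + pair Z (xi_deriv n (W (s t)) 0)" if "n \<in> ?K" for n
        using that mderiv_pair_field[OF field, of n Z t]
        by (simp add: U cs xi_deriv_add linear_simps(1)[OF bounded_linear_pair] pair_xi_deriv_gen_comb[OF recursion Z])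
      then have "(\<Sum>n\<in>?K. A n *v mderiv n (\<lambda>x. U x t) X)
          = (\<Sum>n\<in>?K. A n *v (a t n + pair Z (xi_deriv n (W (s t)) 0)))"
        by (intro sum.cong refl) (simp only:)
      then show ?thesis by (simp only: matrix_vector_right_distrib sum.distrib)
    qed
    moreover have "?E1 (B (conv T (rs X) t)) = ?E1 (B (s t)) - ?E1 (T t (B (s 0)))"
      using conv_DB(2)[OF t] by (simp add: conv[OF t] transient(2)[OF t] linear_simps(2)[OF E1])
    moreover have "?E2 (conv T (rs X) t) = ?E2 (s t) - ?E2 (T t (s 0))"
      by (simp only: conv[OF t] linear_simps(2)[OF E2])
    ultimately show ?thesis by (simp add: remainder_def algebra_simps)
  qed
  obtain K1 where K1: "0 \<le> K1" "\<And>z. norm (?E1 z) \<le> norm z * K1" using bounded_linear.nonneg_bounded[OF E1] by blast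
  obtain K2 where K2: "0 \<le> K2" "\<And>z. norm (?E2 z) \<le> norm z * K2" using bounded_linear.nonneg_bounded[OF E2] by blast
  have "norm (?E1 (T t (B (s 0))) - ?E2 (T t (s 0)))
      \<le> (C * norm (B (s 0)) * K1 + C * norm (s 0) * K2) * exp (- \<gamma> * t)" if "0 \<le> t" for t
  proof -
    have "norm (?E1 (T t (B (s 0))) - ?E2 (T t (s 0))) \<le> norm (?E1 (T t (B (s 0)))) + norm (?E2 (T t (s 0)))"
      by (rule norm_triangle_ineq4)
    also have "\<dots> \<le> norm (T t (B (s 0))) * K1 + norm (T t (s 0)) * K2"
      by (intro add_mono K1 K2)
    also have "\<dots> \<le> (C * exp (- \<gamma> * t) * norm (B (s 0))) * K1 + (C * exp (- \<gamma> * t) * norm (s 0)) * K2"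
      by (intro add_mono mult_right_mono C(2) that K1(1) K2(1))
    finally show ?thesis by (simp add: algebra_simps)
  qed
  then have "(\<lambda>t. norm (vector_derivative (U X) (at t)
      - ((\<Sum>n\<in>?K. A n *v mderiv n (\<lambda>x. U x t) X) + remainder Z A V N W B T (rc X) (rs X) t)))
      \<in> O[at_top](\<lambda>t. exp (- \<gamma> * t))"
    by (intro bigo_exponential_bound) (simp only: error)
  then show "(\<forall>t. U X differentiable (at t)) \<and>
    (\<forall>t\<ge>0. (\<lambda>\<tau>. T (t - \<tau>) (rs X \<tau>)) integrable_on {0..t} \<and> conv T (rs X) t \<in> DB) \<and>
    (\<exists>\<gamma>. \<alpha> < \<gamma> \<and> \<gamma> < \<beta> \<and>
      (\<lambda>t. norm (vector_derivative (U X) (at t)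
        - ((\<Sum>n\<in>{n. mabs n \<le> N}. A n *v mderiv n (\<lambda>x. U x t) X)
           + remainder Z A V N W B T (rc X) (rs X) t)))
      \<in> O[at_top](\<lambda>t. exp (- \<gamma> * t)))"
    using differentiableI_vector[OF U'] has_integral_integrable[OF integral] conv conv_DB(1) \<gamma> by auto
qed

end
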